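(* Let $(M,g)$ be a smooth compact Riemannian manifold with boundary and let $A=\overline{\operatorname{int}A}\subset M$ be a closed subset with $A\cap\partial M\ne\emptyset$ such that the $C^1$ boundary $\partial A$ of $A$ (in the topology of $M$) meets $\partial M$ orthogonally. Let $\widetilde{A}$ be the reflected manifold of $A$. Let $F,H$ be some classes of functions $A\to\mathbb{R}$ and let $E=\partial A\setminus\partial M$ be the set of tomography. Then: (1) If $\mathcal{I}_{\widetilde h}\widetilde f$ determines both $\widetilde h\in\widetilde H$ and $\widetilde f\in\widetilde F$, then $\mathcal{G}_h f$ determines both $h\in H$ and $f\in F$. (2) If $\mathcal{I}_{\widetilde h}\widetilde f$ determines $\widetilde f\in\widetilde F$ for a fixed (known) $\widetilde h\in\widetilde H$, then $\mathcal{G}_h f$ determines $f\in F$ for a fixed (known) $h\in H$.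
   Context: Transforms. For a manifold $N$ with boundary, $\Gamma(N)$ is the set of all geodesics joining boundary points, and for functions $f,h$ on $N$ the attenuated geodesic ray transform is $$\mathcal{I}_h f(\gamma)=\int_0^L f(\gamma(t))\exp\Big(\int_0^t h(\gamma(s))\,ds\Big)dt$$ for unit speed $\gamma:[0,L]\to N$ in $\Gamma(N)$. $\Gamma_E(A)$ is the set of broken rays in $A$ from $E$ to $E$: piecewise geodesic paths that start and end in $\overline{E}$, are geodesics in the interior, and reflect on the reflecting part $R=\partial M\cap\operatorname{int}A$ of the boundary by the usual law (angle of incidence equals angle of reflection); reflections on $E$ are also allowed. The attenuated broken ray transform $\mathcal{G}_h f(\gamma)$ is given by the same formula for $\gamma\in\Gamma_E(A)$. Reflected manifold. Let $A_1=A$, $A_2$ an identical copy, $\eta:A_1\to A_2$ the natural bijection, $R_1=\partial M\cap\operatorname{int}A$ (interior in the topology of $M$), $C_1=\partial M\cap\partial A$, and $\overline{R}_1=R_1\cup C_1$. Then $\widetilde{A}$ is the quotient of the disjoint union $A_1\sqcup A_2$ obtained by identifying $x\in\overline{R}_1$ with $\eta(x)$. It is made into a smooth manifold with boundary using Riemannian boundary normal coordinates near the glued part. The projection $\pi:\widetilde{A}\to A$ sends the class of $x\in A_1$ to $x$ and the class of $y\in A_2$ to $\eta^{-1}(y)$. The metric on $\widetilde{A}$ is $\widetilde g=\pi^*g$; for a function $f$ on $A$, $\widetilde f=f\circ\pi$; for a class $F$ of functions, $\widetilde F=\{\widetilde f: f\in F\}$. *)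

theory Defs
  imports "HOL-Analysis.Analysis"
begin

section \<open>Smoothness up to the boundary in a half-space\<close>

definition e_n :: "'e::euclidean_space" where
  "e_n = (SOME b. b \<in> Basis)"

definition half_space :: "'e::euclidean_space set" where
  "half_space = {x. 0 \<le> x \<bullet> e_n}"

definition wall :: "'e::euclidean_space set" where
  "wall = {x. x \<bullet> e_n = 0}"

definition mirror :: "'e::euclidean_space \<Rightarrow> 'e" where
  "mirror x = x - (2 * (x \<bullet> e_n)) *\<^sub>R e_n"

text \<open>Functions of class \<open>C\<^sup>k\<close>; only meaningful on open sets.\<close>

primrec Ck_on :: "nat \<Rightarrow> 'e::euclidean_space set \<Rightarrow> ('e \<Rightarrow> 'b::real_normed_vector) \<Rightarrow> bool" where
  "Ck_on 0 V f \<longleftrightarrow> continuous_on V f"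
| "Ck_on (Suc k) V f \<longleftrightarrow> f differentiable_on V \<and>
     (\<forall>b\<in>Basis. Ck_on k V (\<lambda>x. frechet_derivative f (at x) b))"

definition smooth_to_boundary :: "'e::euclidean_space set \<Rightarrow> ('e \<Rightarrow> 'b::real_normed_vector) \<Rightarrow> bool" where
  "smooth_to_boundary S f \<longleftrightarrow>
     (\<forall>x\<in>S. \<exists>V F. open V \<and> x \<in> V \<and> (\<forall>k. Ck_on k V F) \<and> (\<forall>y\<in>V \<inter> S. F y = f y))"

section \<open>Riemannian manifolds with boundary\<close>

text \<open>A chart together with the components of the metric in it:
  \<open>cmet c x v w\<close> is the inner product of the coordinate vectors \<open>v\<close>, \<open>w\<close> at the
  coordinate point \<open>x\<close>.\<close>

record ('p, 'e) rchart =
  cdom :: "'p set"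
  cmap :: "'p \<Rightarrow> 'e"
  cmet :: "'e \<Rightarrow> 'e \<Rightarrow> 'e \<Rightarrow> real"

definition is_rchart :: "'p topology \<Rightarrow> ('p, 'e::euclidean_space) rchart \<Rightarrow> bool" where
  "is_rchart X c \<longleftrightarrow>
     openin X (cdom c) \<and>
     openin (top_of_set half_space) (cmap c ` cdom c) \<and>
     homeomorphic_map (subtopology X (cdom c)) (top_of_set (cmap c ` cdom c)) (cmap c) \<and>
     (\<forall>x\<in>cmap c ` cdom c. bilinear (cmet c x) \<and> (\<forall>v w. cmet c x v w = cmet c x w v) \<and>
        (\<forall>v. v \<noteq> 0 \<longrightarrow> 0 < cmet c x v v)) \<and>
     (\<forall>v w. smooth_to_boundary (cmap c ` cdom c) (\<lambda>x. cmet c x v w))"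

definition transition :: "('p, 'e) rchart \<Rightarrow> ('p, 'e) rchart \<Rightarrow> 'e \<Rightarrow> 'e" where
  "transition c d = cmap d \<circ> inv_into (cdom c) (cmap c)"

text \<open>Smooth transition map, and the metric components transform as a covariant 2-tensor.\<close>

definition rcompatible :: "('p, 'e::euclidean_space) rchart \<Rightarrow> ('p, 'e) rchart \<Rightarrow> bool" where
  "rcompatible c d \<longleftrightarrow>
     (let S = cmap c ` (cdom c \<inter> cdom d) in
        smooth_to_boundary S (transition c d) \<and>
        (\<forall>x\<in>S. \<forall>v w. let D = frechet_derivative (transition c d) (at x within S) in
           cmet c x v w = cmet d (transition c d x) (D v) (D w)))"

text \<open>\<open>\<A>\<close> is the maximal smooth atlas, each chart carrying the components of the metric.\<close>

definition riemannian_manifold :: "'p topology \<Rightarrow> ('p, 'e::euclidean_space) rchart set \<Rightarrow> bool" where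
  "riemannian_manifold X \<A> \<longleftrightarrow>
     Hausdorff_space X \<and> second_countable X \<and>
     (\<Union>c\<in>\<A>. cdom c) = topspace X \<and>
     (\<forall>c\<in>\<A>. is_rchart X c) \<and>
     (\<forall>c\<in>\<A>. \<forall>d\<in>\<A>. rcompatible c d) \<and>
     (\<forall>c. is_rchart X c \<and> (\<forall>d\<in>\<A>. rcompatible c d \<and> rcompatible d c) \<longrightarrow> c \<in> \<A>)"

text \<open>The manifold boundary. For charts into the half-space the condition says that the
  \<open>e_n\<close>-coordinate vanishes; the same definition applies to charts whose images are
  other domains with boundary.\<close>

definition bdry :: "('p, 'e::euclidean_space) rchart set \<Rightarrow> 'p set" where
  "bdry \<A> = {p. \<exists>c\<in>\<A>. p \<in> cdom c \<and> cmap c p \<notin> interior (cmap c ` cdom c)}"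

section \<open>Geodesics\<close>

text \<open>The equation \<open>a + \<Gamma>(v,v) = 0\<close> at the point \<open>x\<close>, paired with an arbitrary vector \<open>z\<close>:
  by the Koszul formula \<open>g(\<Gamma>(v,v),z) = D\<^sub>v g(v,z) - D\<^sub>z g(v,v) / 2\<close>.
  Derivatives of the metric are taken within the region \<open>S\<close>; they are unique in all uses
  below, where \<open>S\<close> is the coordinate image of a domain with boundary (or right-angled corner).\<close>

definition geodesic_equation ::
  "('e::euclidean_space \<Rightarrow> 'e \<Rightarrow> 'e \<Rightarrow> real) \<Rightarrow> 'e set \<Rightarrow> 'e \<Rightarrow> 'e \<Rightarrow> 'e \<Rightarrow> bool" where
  "geodesic_equation G S x v a \<longleftrightarrow>
     (\<forall>z D1 D2. ((\<lambda>y. G y v z) has_derivative D1) (at x within S) \<longrightarrow>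
                ((\<lambda>y. G y v v) has_derivative D2) (at x within S) \<longrightarrow>
                G x a z + D1 v - D2 z / 2 = 0)"

text \<open>Unit speed geodesic on \<open>[a,b]\<close> staying in the domain \<open>T\<close>, on which the metric is
  smooth up to the boundary of \<open>T\<close>.\<close>

definition geodesic_in ::
  "('p, 'e::euclidean_space) rchart set \<Rightarrow> 'p set \<Rightarrow> real \<Rightarrow> real \<Rightarrow> (real \<Rightarrow> 'p) \<Rightarrow> bool" where
  "geodesic_in \<A> T a b \<gamma> \<longleftrightarrow>
     \<gamma> ` {a..b} \<subseteq> T \<and>
     (\<forall>t\<in>{a..b}. \<exists>c\<in>\<A>. \<gamma> t \<in> cdom c \<and>
        (\<exists>x' x''. \<forall>s\<in>{a..b}. \<gamma> s \<in> cdom c \<longrightarrow>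
           ((cmap c \<circ> \<gamma>) has_vector_derivative x' s) (at s within {a..b}) \<and>
           (x' has_vector_derivative x'' s) (at s within {a..b}) \<and>
           cmet c (cmap c (\<gamma> s)) (x' s) (x' s) = 1 \<and>
           geodesic_equation (cmet c) (cmap c ` (cdom c \<inter> T)) (cmap c (\<gamma> s)) (x' s) (x'' s)))"

definition C1_curve ::
  "('p, 'e::euclidean_space) rchart set \<Rightarrow> real \<Rightarrow> (real \<Rightarrow> 'p) \<Rightarrow> bool" where
  "C1_curve \<A> L \<gamma> \<longleftrightarrow>
     (\<forall>t\<in>{0..L}. \<exists>c\<in>\<A>. \<gamma> t \<in> cdom c \<and>
        (\<exists>x'. continuous_on {s\<in>{0..L}. \<gamma> s \<in> cdom c} x' \<and>
          (\<forall>s\<in>{0..L}. \<gamma> s \<in> cdom c \<longrightarrow>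
             ((cmap c \<circ> \<gamma>) has_vector_derivative x' s) (at s within {0..L}))))"

definition subdivision :: "real \<Rightarrow> nat \<Rightarrow> (nat \<Rightarrow> real) \<Rightarrow> bool" where
  "subdivision L k P \<longleftrightarrow> 0 < k \<and> P 0 = 0 \<and> P k = L \<and> (\<forall>i<k. P i < P (Suc i))"

text \<open>Geodesics for a metric that is smooth on each of the closed domains in \<open>\<S>\<close> but whose
  normal derivative may jump across the interface \<open>Z\<close> between them:
  \<open>C\<^sup>1\<close> curves composed of finitely many geodesics of the single domains, changing domain
  only on \<open>Z\<close>. When the metric is smooth across \<open>Z\<close>, these are its usual geodesics.
  \<open>joining_geodesics\<close> is the set of those (as pairs of length and curve) which join
  boundary points.\<close>

definition joining_geodesics ::
  "'p topology \<Rightarrow> ('p, 'e::euclidean_space) rchart set \<Rightarrow> 'p set set \<Rightarrow> 'p set \<Rightarrow> (real \<times> (real \<Rightarrow> 'p)) set"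
  where
  "joining_geodesics Y \<A> \<S> Z = {(L, \<gamma>). 0 < L \<and>
     continuous_map (top_of_set {0..L}) Y \<gamma> \<and> C1_curve \<A> L \<gamma> \<and>
     \<gamma> 0 \<in> bdry \<A> \<and> \<gamma> L \<in> bdry \<A> \<and>
     (\<exists>k P. subdivision L k P \<and>
        (\<forall>i<k. \<exists>T\<in>\<S>. geodesic_in \<A> T (P i) (P (Suc i)) \<gamma>) \<and>
        (\<forall>i\<in>{0<..<k}. \<gamma> (P i) \<in> Z))}"

section \<open>Domains with \<open>C\<^sup>1\<close> boundary in a manifold\<close>

definition C1_defining ::
  "'p topology \<Rightarrow> 'p set \<Rightarrow> ('p, 'e::euclidean_space) rchart \<Rightarrow> ('e \<Rightarrow> real) \<Rightarrow> bool" where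
  "C1_defining X A c \<rho> \<longleftrightarrow>
     (\<exists>V. open V \<and> cmap c ` cdom c \<subseteq> V \<and> Ck_on 1 V \<rho>) \<and>
     (\<forall>q\<in>cdom c. (q \<in> A \<longleftrightarrow> \<rho> (cmap c q) \<le> 0) \<and>
        (q \<in> X frontier_of A \<longleftrightarrow> \<rho> (cmap c q) = 0) \<and>
        (\<rho> (cmap c q) = 0 \<longrightarrow> frechet_derivative \<rho> (at (cmap c q)) \<noteq> (\<lambda>_. 0)))"

definition has_C1_frontier ::
  "'p topology \<Rightarrow> ('p, 'e::euclidean_space) rchart set \<Rightarrow> 'p set \<Rightarrow> bool" where
  "has_C1_frontier X \<A> A \<longleftrightarrow>
     (\<forall>p\<in>X frontier_of A. \<exists>c\<in>\<A>. \<exists>\<rho>. p \<in> cdom c \<and> C1_defining X A c \<rho>)"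

definition normal_at :: "('p, 'e) rchart \<Rightarrow> 'p \<Rightarrow> 'e set \<Rightarrow> 'e \<Rightarrow> bool" where
  "normal_at c p T \<nu> \<longleftrightarrow> (\<forall>z\<in>T. cmet c (cmap c p) \<nu> z = 0)"

text \<open>Tangent space of the topological boundary of \<open>A\<close>, given a local defining function;
  the tangent space of the manifold boundary is \<open>wall\<close>.\<close>

definition frontier_tangent :: "('p, 'e::euclidean_space) rchart \<Rightarrow> ('e \<Rightarrow> real) \<Rightarrow> 'p \<Rightarrow> 'e set" where
  "frontier_tangent c \<rho> p = {z. frechet_derivative \<rho> (at (cmap c p)) z = 0}"

definition frontier_orthogonal ::
  "'p topology \<Rightarrow> ('p, 'e::euclidean_space) rchart set \<Rightarrow> 'p set \<Rightarrow> bool" where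
  "frontier_orthogonal X \<A> A \<longleftrightarrow>
     (\<forall>p\<in>X frontier_of A \<inter> bdry \<A>. \<forall>c\<in>\<A>. \<forall>\<rho>. p \<in> cdom c \<and> C1_defining X A c \<rho> \<longrightarrow>
        (\<forall>\<nu> \<mu>. normal_at c p wall \<nu> \<and> normal_at c p (frontier_tangent c \<rho> p) \<mu> \<longrightarrow>
           cmet c (cmap c p) \<nu> \<mu> = 0))"

section \<open>Broken rays\<close>

definition tomography_set ::
  "'p topology \<Rightarrow> ('p, 'e::euclidean_space) rchart set \<Rightarrow> 'p set \<Rightarrow> 'p set" where
  "tomography_set X \<A> A = X frontier_of A - bdry \<A>"

text \<open>The reflecting part together with its edge in the topological boundary of \<open>A\<close>.\<close>

definition reflecting_closed ::
  "'p topology \<Rightarrow> ('p, 'e::euclidean_space) rchart set \<Rightarrow> 'p set \<Rightarrow> 'p set" where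
  "reflecting_closed X \<A> A = (bdry \<A> \<inter> X interior_of A) \<union> (bdry \<A> \<inter> X frontier_of A)"

text \<open>At time \<open>t\<close> the velocity in the chart \<open>c\<close> is reflected in the hyperplane \<open>T\<close>:
  its normal component changes sign and its tangential component is preserved.\<close>

definition reflects_in ::
  "('p, 'e::real_normed_vector) rchart \<Rightarrow> 'e set \<Rightarrow> (real \<Rightarrow> 'p) \<Rightarrow> real \<Rightarrow> bool" where
  "reflects_in c T \<gamma> t \<longleftrightarrow>
     (\<exists>v w \<nu>. ((cmap c \<circ> \<gamma>) has_vector_derivative v) (at_left t) \<and>
        ((cmap c \<circ> \<gamma>) has_vector_derivative w) (at_right t) \<and>
        normal_at c (\<gamma> t) T \<nu> \<and> cmet c (cmap c (\<gamma> t)) \<nu> \<nu> = 1 \<and>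
        w = v - (2 * cmet c (cmap c (\<gamma> t)) v \<nu>) *\<^sub>R \<nu>)"

text \<open>Tangential contact of a geodesic piece with the boundary is allowed; there the
  reflection law holds trivially.\<close>

definition broken_rays ::
  "'p topology \<Rightarrow> ('p, 'e::euclidean_space) rchart set \<Rightarrow> 'p set \<Rightarrow> (real \<times> (real \<Rightarrow> 'p)) set" where
  "broken_rays X \<A> A = {(L, \<gamma>). 0 < L \<and>
     continuous_map (top_of_set {0..L}) (subtopology X A) \<gamma> \<and>
     \<gamma> 0 \<in> X closure_of (tomography_set X \<A> A) \<and>
     \<gamma> L \<in> X closure_of (tomography_set X \<A> A) \<and>
     (\<exists>k P. subdivision L k P \<and>
        (\<forall>i<k. geodesic_in \<A> A (P i) (P (Suc i)) \<gamma>) \<and>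
        (\<forall>i\<in>{0<..<k}.
           (\<gamma> (P i) \<in> reflecting_closed X \<A> A \<and>
              (\<exists>c\<in>\<A>. \<gamma> (P i) \<in> cdom c \<and> reflects_in c wall \<gamma> (P i))) \<or>
           (\<gamma> (P i) \<in> tomography_set X \<A> A \<and>
              (\<exists>c\<in>\<A>. \<exists>\<rho>. \<gamma> (P i) \<in> cdom c \<and> C1_defining X A c \<rho> \<and>
                 reflects_in c (frontier_tangent c \<rho> (\<gamma> (P i))) \<gamma> (P i)))))}"

section \<open>Boundary normal coordinates\<close>

text \<open>The point with coordinates \<open>y + s e_n\<close>, where \<open>y\<close> is in the wall, is reached at time \<open>s\<close>
  by the unit speed geodesic that starts at the boundary point with coordinates \<open>y\<close> in the
  direction of the inner unit normal.\<close>

definition boundary_normal_chart ::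
  "'p topology \<Rightarrow> ('p, 'e::euclidean_space) rchart set \<Rightarrow> ('p, 'e) rchart \<Rightarrow> bool" where
  "boundary_normal_chart X \<A> c \<longleftrightarrow> c \<in> \<A> \<and>
     (\<exists>W \<epsilon>. 0 < \<epsilon> \<and> openin (top_of_set wall) W \<and>
        cmap c ` cdom c = {y + s *\<^sub>R e_n | y s. y \<in> W \<and> 0 \<le> s \<and> s < \<epsilon>} \<and>
        (\<forall>y\<in>W. cmet c y e_n e_n = 1 \<and> (\<forall>z\<in>wall. cmet c y e_n z = 0) \<and>
           (\<forall>b. 0 < b \<and> b < \<epsilon> \<longrightarrow>
              geodesic_in \<A> (topspace X) 0 b
                (\<lambda>s. inv_into (cdom c) (cmap c) (y + s *\<^sub>R e_n)))))"

section \<open>The reflected manifold\<close>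

text \<open>The two copies of \<open>A\<close> are \<open>{True} \<times> A\<close> and \<open>{False} \<times> A\<close>.\<close>

definition glue_rel ::
  "'p topology \<Rightarrow> ('p, 'e::euclidean_space) rchart set \<Rightarrow> 'p set \<Rightarrow> ((bool \<times> 'p) \<times> (bool \<times> 'p)) set" where
  "glue_rel X \<A> A = {((i, p), (j, q)). p = q \<and> p \<in> A \<and> (i = j \<or> p \<in> reflecting_closed X \<A> A)}"

definition glue_class ::
  "'p topology \<Rightarrow> ('p, 'e::euclidean_space) rchart set \<Rightarrow> 'p set \<Rightarrow> bool \<times> 'p \<Rightarrow> (bool \<times> 'p) set" where
  "glue_class X \<A> A z = glue_rel X \<A> A `` {z}"

definition reflected_carrier ::
  "'p topology \<Rightarrow> ('p, 'e::euclidean_space) rchart set \<Rightarrow> 'p set \<Rightarrow> (bool \<times> 'p) set set" where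
  "reflected_carrier X \<A> A = (UNIV \<times> A) // glue_rel X \<A> A"

text \<open>Quotient topology: a set of classes is open iff its union is open in the disjoint union.\<close>

definition reflected_space ::
  "'p topology \<Rightarrow> ('p, 'e::euclidean_space) rchart set \<Rightarrow> 'p set \<Rightarrow> (bool \<times> 'p) set topology" where
  "reflected_space X \<A> A = topology (\<lambda>W. W \<subseteq> reflected_carrier X \<A> A \<and>
     openin (sum_topology (\<lambda>_::bool. subtopology X A) UNIV) (\<Union>W))"

definition reflected_proj :: "(bool \<times> 'p) set \<Rightarrow> 'p" where
  "reflected_proj q = snd (SOME z. z \<in> q)"

lemma istopology_reflected_space:
  fixes X :: "'p topology" and \<A> :: "('p, 'e::euclidean_space) rchart set"
  shows "istopology (\<lambda>W. W \<subseteq> reflected_carrier X \<A> A \<and>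
     openin (sum_topology (\<lambda>_::bool. subtopology X A) UNIV) (\<Union>W))"
proof -
  have eq: "equiv (UNIV \<times> A) (glue_rel X \<A> A)"
    by (auto simp: equiv_def refl_on_def sym_def trans_def glue_rel_def)
  have "\<Union>(S \<inter> T) = \<Union>S \<inter> \<Union>T"
    if "S \<subseteq> reflected_carrier X \<A> A" "T \<subseteq> reflected_carrier X \<A> A" for S T
  proof
    show "\<Union>S \<inter> \<Union>T \<subseteq> \<Union>(S \<inter> T)"
    proof
      fix z assume "z \<in> \<Union>S \<inter> \<Union>T"
      then obtain c d where cd: "c \<in> S" "d \<in> T" "z \<in> c" "z \<in> d" by auto
      moreover have "c = d"
        using quotient_disj[OF eq, of c d] cd that unfolding reflected_carrier_def by blast
      ultimately show "z \<in> \<Union>(S \<inter> T)" by auto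
    qed
  qed auto
  moreover have "openin Y (\<Union>(\<Union>\<K>))"
    if "\<And>K. K \<in> \<K> \<Longrightarrow> openin Y (\<Union>K)"
    for Y and \<K> :: "(bool \<times> 'p) set set set"
  proof -
    have "\<Union>(\<Union>\<K>) = \<Union>(Union ` \<K>)" by auto
    then show ?thesis using that by auto
  qed
  ultimately show ?thesis
    unfolding istopology_def by (auto simp: openin_Int)
qed

lemma reflected_proj_glue_class:
  assumes "p \<in> A"
  shows "reflected_proj (glue_class X \<A> A (i, p)) = p"
proof -
  have "(i, p) \<in> glue_class X \<A> A (i, p)"
    using assms by (auto simp: glue_class_def glue_rel_def)
  then have "(SOME z. z \<in> glue_class X \<A> A (i, p)) \<in> glue_class X \<A> A (i, p)"
    by (rule someI)
  then show ?thesis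
    by (auto simp: reflected_proj_def glue_class_def glue_rel_def)
qed

definition lift_set ::
  "'p topology \<Rightarrow> ('p, 'e::euclidean_space) rchart set \<Rightarrow> 'p set \<Rightarrow> bool \<Rightarrow> 'p set \<Rightarrow> (bool \<times> 'p) set set" where
  "lift_set X \<A> A i U = glue_class X \<A> A ` ({i} \<times> (U \<inter> A))"

definition sheet ::
  "'p topology \<Rightarrow> ('p, 'e::euclidean_space) rchart set \<Rightarrow> 'p set \<Rightarrow> bool \<Rightarrow> (bool \<times> 'p) set set" where
  "sheet X \<A> A i = lift_set X \<A> A i A"

text \<open>Charts away from the glued part, on one copy of \<open>A\<close>; here the projection is the
  identity in coordinates.\<close>

definition sheet_chart ::
  "'p topology \<Rightarrow> ('p, 'e::euclidean_space) rchart set \<Rightarrow> 'p set \<Rightarrow> bool \<Rightarrow> ('p, 'e) rchart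
     \<Rightarrow> ((bool \<times> 'p) set, 'e) rchart" where
  "sheet_chart X \<A> A i c =
     \<lparr>cdom = lift_set X \<A> A i (cdom c), cmap = cmap c \<circ> reflected_proj, cmet = cmet c\<rparr>"

text \<open>Charts at the glued part: boundary normal coordinates on the first copy, their mirror
  image on the second. In these coordinates the projection is the identity on the half-space
  and the linear map \<open>mirror\<close> on the opposite half-space, so the pulled back metric is as below.
  At the wall both expressions agree, since there \<open>mirror\<close> is an isometry of the metric.\<close>

definition reflected_chart ::
  "'p topology \<Rightarrow> ('p, 'e::euclidean_space) rchart set \<Rightarrow> 'p set \<Rightarrow> ('p, 'e) rchart
     \<Rightarrow> ((bool \<times> 'p) set, 'e) rchart" where
  "reflected_chart X \<A> A c =
     \<lparr>cdom = lift_set X \<A> A True (cdom c) \<union> lift_set X \<A> A False (cdom c),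
      cmap = (\<lambda>q. if q \<in> sheet X \<A> A True then cmap c (reflected_proj q)
                   else mirror (cmap c (reflected_proj q))),
      cmet = (\<lambda>x v w. if x \<in> half_space then cmet c x v w
                       else cmet c (mirror x) (mirror v) (mirror w))\<rparr>"

definition reflected_charts ::
  "'p topology \<Rightarrow> ('p, 'e::euclidean_space) rchart set \<Rightarrow> 'p set \<Rightarrow> ((bool \<times> 'p) set, 'e) rchart set" where
  "reflected_charts X \<A> A =
     {sheet_chart X \<A> A i c | i c. c \<in> \<A> \<and> cdom c \<inter> A \<inter> bdry \<A> = {}} \<union>
     {reflected_chart X \<A> A c | c. boundary_normal_chart X \<A> c}"

definition reflected_geodesics ::
  "'p topology \<Rightarrow> ('p, 'e::euclidean_space) rchart set \<Rightarrow> 'p set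
     \<Rightarrow> (real \<times> (real \<Rightarrow> (bool \<times> 'p) set)) set" where
  "reflected_geodesics X \<A> A =
     joining_geodesics (reflected_space X \<A> A) (reflected_charts X \<A> A)
       (range (sheet X \<A> A)) (sheet X \<A> A True \<inter> sheet X \<A> A False)"

section \<open>Attenuated ray transforms\<close>

definition ray_transform ::
  "('p \<Rightarrow> real) \<Rightarrow> ('p \<Rightarrow> real) \<Rightarrow> real \<times> (real \<Rightarrow> 'p) \<Rightarrow> real" where
  "ray_transform h f = (\<lambda>(L, \<gamma>).
     integral {0..L} (\<lambda>t. f (\<gamma> t) * exp (integral {0..t} (\<lambda>s. h (\<gamma> s)))))"

text \<open>Functions on \<open>N\<close> are represented by functions on the whole type, compared on \<open>N\<close>.\<close>

definition determines_both ::
  "'p set \<Rightarrow> (real \<times> (real \<Rightarrow> 'p)) set \<Rightarrow> ('p \<Rightarrow> real) set \<Rightarrow> ('p \<Rightarrow> real) set \<Rightarrow> bool" where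
  "determines_both N \<Gamma> F H \<longleftrightarrow>
     (\<forall>f\<in>F. \<forall>f'\<in>F. \<forall>h\<in>H. \<forall>h'\<in>H.
        (\<forall>\<gamma>\<in>\<Gamma>. ray_transform h f \<gamma> = ray_transform h' f' \<gamma>) \<longrightarrow>
        (\<forall>x\<in>N. h x = h' x) \<and> (\<forall>x\<in>N. f x = f' x))"

definition determines_for ::
  "('p \<Rightarrow> real) \<Rightarrow> 'p set \<Rightarrow> (real \<times> (real \<Rightarrow> 'p)) set \<Rightarrow> ('p \<Rightarrow> real) set \<Rightarrow> bool" where
  "determines_for h N \<Gamma> F \<longleftrightarrow>
     (\<forall>f\<in>F. \<forall>f'\<in>F.
        (\<forall>\<gamma>\<in>\<Gamma>. ray_transform h f \<gamma> = ray_transform h f' \<gamma>) \<longrightarrow> (\<forall>x\<in>N. f x = f' x))"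

definition lift_fun :: "('p \<Rightarrow> real) \<Rightarrow> (bool \<times> 'p) set \<Rightarrow> real" where
  "lift_fun f = f \<circ> reflected_proj"

end

theory Submission
  imports Defs
begin

text \<open>
  The theorem holds because every geodesic of the reflected manifold that joins boundary points
  projects to a broken ray of the same length (\<open>reflected_geodesic_project\<close>). A lifted function
  takes along the geodesic the values that the original function takes along the projection, so
  the two attenuated transforms agree (\<open>ray_transform_lift\<close>). If two sets of data on \<open>A\<close> have
  the same broken ray transform, their lifts therefore have the same geodesic ray transform; when
  that transform determines the lifts, the data agree on \<open>A\<close>, since each point of \<open>A\<close> has
  a preimage in the reflected manifold. Broken rays that also reflect on the tomography set may fail
  to be such projections, but additional rays can only help to determine the data.

  Three facts make the projection a broken ray.

  On one closed sheet the projection is an isometry. In coordinates it is the identity or the mirror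
  map, and the metric is the pulled back one, so the geodesic equation is preserved
  (\<open>geodesic_in_project\<close>).

  Where the geodesic meets the glued part, boundary normal coordinates make the unit normal of the
  boundary the coordinate vector \<open>e_n\<close>, and the two sides of the chart are exchanged by the mirror
  map. A velocity that is continuous in the reflected chart hence projects to a pair of one-sided
  velocities related by the reflection law (\<open>crossing_reflects\<close>).

  The end points project to the closure of the tomography set. The reflected manifold has no boundary
  over the interior of \<open>A\<close>, the half-balls of the two copies forming a full ball there
  (\<open>reflected_bdry_in_frontier\<close>). Over the frontier of \<open>A\<close>, the only points outside the
  tomography set are the corners where the frontier meets the boundary of the manifold. There the
  orthogonality makes the two hypersurfaces transversal, so that the frontier contains points off
  the boundary arbitrarily close to the corner (\<open>corner_in_closure_tomography_set\<close>).
\<close>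

section \<open>The mirror map\<close>

lemma e_n_in_Basis: "(e_n :: 'e::euclidean_space) \<in> Basis"
  unfolding e_n_def by (rule someI_ex) (use nonempty_Basis in blast)

lemma e_n_inner_e_n [simp]: "e_n \<bullet> e_n = 1"
  by (rule inner_same_Basis[OF e_n_in_Basis])

lemma mirror_inner_e_n [simp]: "mirror x \<bullet> e_n = - (x \<bullet> e_n)"
  by (simp add: mirror_def inner_diff_left)

lemma mirror_mirror [simp]: "mirror (mirror x) = x"
  by (simp add: mirror_def inner_diff_left scaleR_left_diff_distrib)

lemma mirror_wall: "x \<bullet> e_n = 0 \<Longrightarrow> mirror x = x"
  by (simp add: mirror_def)

lemma linear_mirror: "linear mirror"
  by (rule linearI) (auto simp: mirror_def inner_add_left algebra_simps)

text \<open>In a reflected chart, \<open>flip i\<close> takes the coordinates of the projection of a point of the sheet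
  \<open>i\<close> to the coordinates of the point itself.\<close>

definition flip :: "bool \<Rightarrow> 'e::euclidean_space \<Rightarrow> 'e" where
  "flip i = (if i then id else mirror)"

lemma flip_flip [simp]: "flip i (flip i x) = x"
  by (simp add: flip_def)

lemma linear_flip: "linear (flip i)"
  by (auto simp: flip_def linear_mirror linear_id)

lemma flip_wall: "x \<bullet> e_n = 0 \<Longrightarrow> flip i x = x"
  by (simp add: flip_def mirror_wall)

lemma flip_other: "i \<noteq> j \<Longrightarrow> flip j u = mirror (flip i u)"
  by (cases i; cases j) (auto simp: flip_def)

lemma half_space_interior:
  assumes "openin (top_of_set half_space) S" "x \<in> S" "0 < x \<bullet> e_n"
  shows "x \<in> interior S"
proof -
  obtain W where W: "open W" "S = half_space \<inter> W"
    using assms(1) by (auto simp: openin_open)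
  have "open (W \<inter> {y. 0 < y \<bullet> e_n})"
    by (intro open_Int W open_Collect_less continuous_intros)
  moreover have "W \<inter> {y. 0 < y \<bullet> e_n} \<subseteq> S"
    using W by (auto simp: half_space_def)
  ultimately show ?thesis
    using assms W by (intro interiorI[of "W \<inter> {y. 0 < y \<bullet> e_n}"]) auto
qed

text \<open>The double of a relatively open subset of the half-space is the preimage of that subset under
  the continuous map folding the space onto the half-space.\<close>

lemma open_double:
  fixes S :: "'e::euclidean_space set"
  assumes "openin (top_of_set half_space) S"
  shows "open (S \<union> mirror ` S)"
proof -
  obtain W where W: "open W" "S = half_space \<inter> W"
    using assms by (auto simp: openin_open)
  let ?fold = "\<lambda>x::'e. x + (\<bar>x \<bullet> e_n\<bar> - x \<bullet> e_n) *\<^sub>R e_n"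
  have fold: "?fold x = (if x \<in> half_space then x else mirror x)" for x
    by (auto simp: half_space_def mirror_def)
  have half: "x \<notin> half_space \<Longrightarrow> mirror x \<in> half_space" for x :: 'e
    by (auto simp: half_space_def)
  have "S \<union> mirror ` S = ?fold -` W"
  proof (intro set_eqI iffI)
    fix x assume "x \<in> S \<union> mirror ` S"
    then consider "x \<in> S" | y where "y \<in> S" "x = mirror y" by blast
    then show "x \<in> ?fold -` W"
    proof cases
      case 2
      then show ?thesis
        using W by (cases "x \<in> half_space") (auto simp: fold half_space_def mirror_wall)
    qed (use W in \<open>auto simp: fold\<close>)
  next
    fix x assume "x \<in> ?fold -` W"
    then show "x \<in> S \<union> mirror ` S"
      using W half[of x] by (auto simp: fold image_iff intro!: bexI[of _ "mirror x"] split: if_splits)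
  qed
  moreover have "open (?fold -` W)"
    by (intro open_vimage W continuous_intros)
  ultimately show ?thesis by simp
qed

section \<open>Charts and the manifold boundary\<close>

lemma rchart_inj:
  assumes "is_rchart X c"
  shows "inj_on (cmap c) (cdom c)"
proof -
  have "homeomorphic_map (subtopology X (cdom c)) (top_of_set (cmap c ` cdom c)) (cmap c)"
    using assms by (simp add: is_rchart_def)
  then have "inj_on (cmap c) (topspace (subtopology X (cdom c)))"
    by (rule homeomorphic_imp_injective_map)
  moreover have "cdom c \<subseteq> topspace X"
    using assms by (simp add: is_rchart_def openin_subset)
  ultimately show ?thesis
    by (simp add: Int_absorb1)
qed

lemma rchart_open_image:
  assumes "is_rchart X c" "openin X U"
  shows "openin (top_of_set half_space) (cmap c ` (cdom c \<inter> U))"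
proof -
  have h: "homeomorphic_map (subtopology X (cdom c)) (top_of_set (cmap c ` cdom c)) (cmap c)"
    and o: "openin (top_of_set half_space) (cmap c ` cdom c)"
    using assms by (simp_all add: is_rchart_def)
  have "openin (subtopology X (cdom c)) (cdom c \<inter> U)"
    using assms(2) by (auto simp: openin_subtopology)
  then have "openin (top_of_set (cmap c ` cdom c)) (cmap c ` (cdom c \<inter> U))"
    using homeomorphic_imp_open_map[OF h] by (auto simp: open_map_def)
  then show ?thesis
    using o openin_trans by blast
qed

lemma rchart_half_space:
  assumes "is_rchart X c" "p \<in> cdom c"
  shows "0 \<le> cmap c p \<bullet> e_n"
proof -
  have "cmap c ` cdom c \<subseteq> half_space"
    using assms(1) unfolding is_rchart_def by (blast dest: openin_imp_subset)
  then show ?thesis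
    using assms by (auto simp: half_space_def)
qed

text \<open>Being an interior point does not depend on the chart: the change of charts is continuous and
  injective, so by invariance of domain it takes neighbourhoods in the model space to
  neighbourhoods.\<close>

lemma interior_chart_independent:
  fixes c d :: "('p, 'e::euclidean_space) rchart"
  assumes c: "is_rchart X c" and d: "is_rchart X d"
    and p: "p \<in> cdom c" "p \<in> cdom d"
    and int: "cmap c p \<in> interior (cmap c ` cdom c)"
  shows "cmap d p \<in> interior (cmap d ` cdom d)"
proof -
  have hc: "homeomorphic_map (subtopology X (cdom c)) (top_of_set (cmap c ` cdom c)) (cmap c)"
    and hd: "homeomorphic_map (subtopology X (cdom d)) (top_of_set (cmap d ` cdom d)) (cmap d)"
    and oc: "openin X (cdom c)" and od: "openin X (cdom d)"
    using c d by (simp_all add: is_rchart_def)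
  have sub: "cdom c \<subseteq> topspace X" using oc by (rule openin_subset)
  obtain g where g: "homeomorphic_maps (subtopology X (cdom c)) (top_of_set (cmap c ` cdom c)) (cmap c) g"
    using hc by (auto simp: homeomorphic_map_maps)
  then have gc: "continuous_map (top_of_set (cmap c ` cdom c)) (subtopology X (cdom c)) g"
    and ginv: "\<And>x. x \<in> cdom c \<Longrightarrow> g (cmap c x) = x"
    using sub by (auto simp: homeomorphic_maps_def)
  obtain W where W: "open W" "cmap c ` (cdom c \<inter> cdom d) = half_space \<inter> W"
    using rchart_open_image[OF c od] by (auto simp: openin_open)
  define V where "V = interior (cmap c ` cdom c) \<inter> W"
  have half: "cmap c ` cdom c \<subseteq> half_space"
    using c unfolding is_rchart_def by (blast dest: openin_imp_subset)
  have V: "open V" "V \<subseteq> cmap c ` (cdom c \<inter> cdom d)" "cmap c p \<in> V"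
    using W half interior_subset[of "cmap c ` cdom c"] int p by (auto simp: V_def)
  have gV: "g ` V \<subseteq> cdom c \<inter> cdom d"
    using V(2) ginv by auto
  have "continuous_map (top_of_set V) (subtopology X (cdom c)) g"
    using continuous_map_from_subtopology_mono[OF gc, of V] V(2) by auto
  then have "continuous_map (top_of_set V) (subtopology X (cdom d)) g"
    using gV by (auto simp: continuous_map_in_subtopology)
  then have "continuous_map (top_of_set V) (top_of_set (cmap d ` cdom d)) (cmap d \<circ> g)"
    using homeomorphic_imp_continuous_map[OF hd] continuous_map_compose by blast
  then have cont: "continuous_on V (cmap d \<circ> g)"
    by (auto simp: continuous_map_in_subtopology)
  have "inj_on g V"
    using V(2) ginv by (intro inj_on_inverseI[where g = "cmap c"]) auto
  moreover have "inj_on (cmap d) (g ` V)"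
    using rchart_inj[OF d] gV by (auto elim: inj_on_subset)
  ultimately have inj: "inj_on (cmap d \<circ> g) V"
    by (rule comp_inj_on)
  have "open ((cmap d \<circ> g) ` V)"
    using invariance_of_domain[OF cont V(1) inj] .
  moreover have "(cmap d \<circ> g) ` V \<subseteq> cmap d ` cdom d"
    using gV by auto
  moreover have "cmap d p \<in> (cmap d \<circ> g) ` V"
    using V(3) ginv[OF p(1)] by (auto simp: image_iff intro!: bexI[of _ "cmap c p"])
  ultimately show ?thesis
    by (meson interior_maximal subsetD)
qed

lemma bdry_in_chart:
  assumes "\<forall>d\<in>\<A>. is_rchart X d" "c \<in> \<A>" "p \<in> cdom c"
  shows "p \<in> bdry \<A> \<longleftrightarrow> cmap c p \<notin> interior (cmap c ` cdom c)"
proof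
  assume "p \<in> bdry \<A>"
  then obtain d where "d \<in> \<A>" "p \<in> cdom d" "cmap d p \<notin> interior (cmap d ` cdom d)"
    by (auto simp: bdry_def)
  then show "cmap c p \<notin> interior (cmap c ` cdom c)"
    using interior_chart_independent[of X c d p] assms by auto
next
  assume "cmap c p \<notin> interior (cmap c ` cdom c)"
  then show "p \<in> bdry \<A>"
    using assms(2,3) by (auto simp: bdry_def)
qed

lemma bdry_on_wall:
  assumes "\<forall>d\<in>\<A>. is_rchart X d" "c \<in> \<A>" "p \<in> cdom c" "p \<in> bdry \<A>"
  shows "cmap c p \<bullet> e_n = 0"
proof (rule ccontr)
  assume "cmap c p \<bullet> e_n \<noteq> 0"
  moreover have rc: "is_rchart X c" using assms by blast
  ultimately have "0 < cmap c p \<bullet> e_n"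
    using rchart_half_space[OF rc assms(3)] by linarith
  then have "cmap c p \<in> interior (cmap c ` cdom c)"
    using rc assms(3) by (intro half_space_interior) (auto simp: is_rchart_def)
  then show False
    using bdry_in_chart[OF assms(1-3)] assms(4) by blast
qed

section \<open>The corner lies in the closure of the tomography set\<close>

text \<open>By definiteness, \<open>v \<mapsto> B v\<close> is an isomorphism onto the dual space; the normal vector is the
  preimage of the functional whose kernel is the wall.\<close>

lemma exists_normal_to_wall:
  fixes B :: "'e::euclidean_space \<Rightarrow> 'e \<Rightarrow> real"
  assumes "bilinear B" and pos: "\<And>v. v \<noteq> 0 \<Longrightarrow> 0 < B v v"
  obtains \<nu> where "\<nu> \<noteq> 0" "\<And>z. z \<in> wall \<Longrightarrow> B \<nu> z = 0"
proof -
  define T where "T v = (\<Sum>b\<in>Basis. B v b *\<^sub>R b)" for v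
  have T: "T v \<bullet> z = B v z" for v z
  proof -
    have "B v z = B v (\<Sum>b\<in>Basis. (z \<bullet> b) *\<^sub>R b)"
      by (simp add: euclidean_representation)
    also have "\<dots> = (\<Sum>b\<in>Basis. (z \<bullet> b) * B v b)"
      using assms(1) by (simp add: bilinear_def linear_sum linear_scale)
    also have "\<dots> = T v \<bullet> z"
      by (simp add: T_def inner_sum_left inner_sum_right inner_commute[of _ z] mult.commute)
    finally show ?thesis by simp
  qed
  have "linear T"
    unfolding T_def using assms(1)
    by (intro linearI)
       (auto simp: bilinear_ladd bilinear_lmul scaleR_left_distrib sum.distrib scaleR_sum_right)
  moreover have "inj T"
  proof -
    have "v = 0" if "T v = 0" for v
      using T[of v v] pos[of v] that by force
    then show ?thesis
      using \<open>linear T\<close> by (simp add: linear_injective_0)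
  qed
  ultimately have "surj T"
    by (rule linear_injective_imp_surjective) simp
  then obtain \<nu> where \<nu>: "T \<nu> = e_n" by (metis surjD)
  show thesis
  proof
    show "\<nu> \<noteq> 0"
      using \<nu> linear_0[OF \<open>linear T\<close>] nonzero_Basis[OF e_n_in_Basis] by metis
    show "B \<nu> z = 0" if "z \<in> wall" for z
      using that \<nu> T[of \<nu> z] by (simp add: wall_def inner_commute)
  qed
qed

text \<open>If the two hypersurfaces were tangent, a common normal vector would be orthogonal to itself.\<close>

lemma orthogonal_imp_transversal:
  fixes c :: "('p, 'e::euclidean_space) rchart"
  assumes rc: "is_rchart X c" and c: "c \<in> \<A>" "p \<in> cdom c"
    and p: "p \<in> X frontier_of A" "p \<in> bdry \<A>"
    and \<rho>: "C1_defining X A c \<rho>"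
    and orth: "frontier_orthogonal X \<A> A"
    and D: "(\<rho> has_derivative D) (at (cmap c p))"
  obtains w where "w \<in> wall" "0 < D w"
proof -
  have fd: "frechet_derivative \<rho> (at (cmap c p)) = D"
    using frechet_derivative_at[OF D] by simp
  have lin: "linear D"
    using D by (simp add: has_derivative_linear)
  have D0: "D \<noteq> (\<lambda>_. 0)"
    using \<rho> p c fd by (auto simp: C1_defining_def)
  have "\<exists>w\<in>wall. D w \<noteq> 0"
  proof (rule ccontr)
    assume "\<not> ?thesis"
    then have van: "\<And>w. w \<in> wall \<Longrightarrow> D w = 0" by blast
    have Dv: "D v = (v \<bullet> e_n) * D e_n" for v
    proof -
      have "v - (v \<bullet> e_n) *\<^sub>R e_n \<in> wall"
        by (simp add: wall_def inner_diff_left)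
      from van[OF this] show ?thesis
        using lin by (simp add: linear_diff linear_scale)
    qed
    have "D e_n \<noteq> 0"
    proof
      assume "D e_n = 0"
      then have "D v = 0" for v using Dv[of v] by simp
      then show False using D0 by blast
    qed
    then have "D z = 0 \<longleftrightarrow> z \<bullet> e_n = 0" for z
      using Dv[of z] by simp
    then have ft: "frontier_tangent c \<rho> p = wall"
      by (simp add: frontier_tangent_def fd wall_def)
    have met: "bilinear (cmet c (cmap c p))" "\<And>v. v \<noteq> 0 \<Longrightarrow> 0 < cmet c (cmap c p) v v"
      using rc c by (auto simp: is_rchart_def)
    obtain \<nu> where "\<nu> \<noteq> 0" "\<And>z. z \<in> wall \<Longrightarrow> cmet c (cmap c p) \<nu> z = 0"
      using exists_normal_to_wall[of "cmet c (cmap c p)"] met by blast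
    then have "normal_at c p wall \<nu>" "normal_at c p (frontier_tangent c \<rho> p) \<nu>"
      by (simp_all add: normal_at_def ft)
    then have "cmet c (cmap c p) \<nu> \<nu> = 0"
      using orth p c \<rho> unfolding frontier_orthogonal_def by blast
    then show False using met(2)[OF \<open>\<nu> \<noteq> 0\<close>] by simp
  qed
  then obtain w where w: "w \<in> wall" "D w \<noteq> 0" by blast
  show thesis
  proof (cases "0 < D w")
    case False
    then have "- w \<in> wall" "0 < D (- w)"
      using w lin by (auto simp: wall_def linear_neg)
    then show ?thesis by (rule that)
  qed (use w that in blast)
qed

text \<open>Transversality makes the defining function change sign along a direction tangent to the wall.
  The change of sign survives a small shift off the wall, and the intermediate value theorem then
  produces a zero off the wall.\<close>

lemma zeros_off_wall:
  fixes x w :: "'e::euclidean_space"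
  assumes V: "open V" "x \<in> V" and \<rho>: "continuous_on V \<rho>" "\<rho> x = (0::real)"
    and D: "(\<rho> has_derivative D) (at x)" and w: "w \<in> wall" "0 < D w"
    and x: "x \<bullet> e_n = 0"
  obtains y where "y \<in> V" "\<rho> y = 0" "0 < y \<bullet> e_n"
proof -
  have line: "((\<lambda>t. \<rho> (x + t *\<^sub>R w)) has_real_derivative D w) (at 0)"
  proof -
    have 1: "((\<lambda>t::real. x + t *\<^sub>R w) has_derivative (\<lambda>t. t *\<^sub>R w)) (at 0)"
      by (auto intro!: derivative_eq_intros)
    have 2: "(\<rho> has_derivative D) (at (x + (0::real) *\<^sub>R w))"
      using D by simp
    have "((\<lambda>t. \<rho> (x + t *\<^sub>R w)) has_derivative (\<lambda>t. D (t *\<^sub>R w))) (at 0)"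
      using diff_chain_at[OF 1 2] by (simp add: o_def)
    then show ?thesis
      using linear_scale[OF has_derivative_linear[OF D]]
      by (simp add: has_field_derivative_def mult.commute[of _ "D w"])
  qed
  obtain d1 where d1: "0 < d1" "\<And>h. \<lbrakk>0 < h; h < d1\<rbrakk> \<Longrightarrow> 0 < \<rho> (x + h *\<^sub>R w)"
    using DERIV_pos_inc_right[OF line w(2)] \<rho>(2) by auto
  obtain d2 where d2: "0 < d2" "\<And>h. \<lbrakk>0 < h; h < d2\<rbrakk> \<Longrightarrow> \<rho> (x - h *\<^sub>R w) < 0"
    using DERIV_pos_inc_left[OF line w(2)] \<rho>(2) by auto
  obtain e where e: "0 < e" "ball x e \<subseteq> V"
    using V open_contains_ball by blast
  \<comment> \<open>The whole segment of half-length \<open>\<delta>\<close>, shifted by less than \<open>e / 2\<close>, stays in the ball.\<close>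
  define \<delta> where "\<delta> = min (min (d1/2) (d2/2)) (e / (2 * (norm w + 1)))"
  have pos1: "0 < 2 * (norm w + 1)"
    by (smt (verit) norm_ge_zero)
  have \<delta>: "0 < \<delta>" "\<delta> < d1" "\<delta> < d2"
    using d1 d2 e pos1 by (auto simp: \<delta>_def min_less_iff_disj)
  have "\<delta> * (norm w + 1) \<le> e / (2 * (norm w + 1)) * (norm w + 1)"
    using pos1 by (intro mult_right_mono) (auto simp: \<delta>_def)
  also have "\<dots> = e / 2"
    using pos1 by (simp add: field_simps)
  finally have small: "\<delta> * norm w \<le> e / 2"
    using \<delta> by (simp add: algebra_simps)
  have inV: "x + t *\<^sub>R w + s *\<^sub>R e_n \<in> V" if "\<bar>t\<bar> \<le> \<delta>" "\<bar>s\<bar> < e / 2" for t s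
  proof -
    have "norm (t *\<^sub>R w + s *\<^sub>R e_n) \<le> \<bar>t\<bar> * norm w + \<bar>s\<bar>"
      using norm_triangle_ineq[of "t *\<^sub>R w" "s *\<^sub>R e_n"]
      by (simp add: norm_Basis[OF e_n_in_Basis])
    also have "\<bar>t\<bar> * norm w \<le> \<delta> * norm w"
      using that by (intro mult_right_mono) auto
    finally have "norm (t *\<^sub>R w + s *\<^sub>R e_n) < e"
      using small that by linarith
    then have "x + (t *\<^sub>R w + s *\<^sub>R e_n) \<in> ball x e"
      by (simp only: mem_ball dist_norm norm_minus_commute[of x]) simp
    then show ?thesis using e by (auto simp: add.assoc)
  qed
  have shift: "((\<lambda>s. \<rho> (x + t *\<^sub>R w + s *\<^sub>R e_n)) \<longlongrightarrow> \<rho> (x + t *\<^sub>R w)) (at_right 0)"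
    if "\<bar>t\<bar> \<le> \<delta>" for t
  proof -
    have "isCont \<rho> (x + t *\<^sub>R w)"
      using inV[OF that, of 0] e V(1) \<rho>(1) by (simp add: continuous_on_eq_continuous_at)
    moreover have "((\<lambda>s. x + t *\<^sub>R w + s *\<^sub>R e_n) \<longlongrightarrow> x + t *\<^sub>R w + 0 *\<^sub>R e_n) (at_right 0)"
      by (intro tendsto_intros)
    ultimately show ?thesis
      using isCont_tendsto_compose[of "x + t *\<^sub>R w" \<rho>] by simp
  qed
  have "0 < \<rho> (x + \<delta> *\<^sub>R w)" "\<rho> (x + (- \<delta>) *\<^sub>R w) < 0"
    using d1(2)[of \<delta>] d2(2)[of \<delta>] \<delta> by auto
  then have "\<forall>\<^sub>F s in at_right 0. 0 < \<rho> (x + \<delta> *\<^sub>R w + s *\<^sub>R e_n)"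
    "\<forall>\<^sub>F s in at_right 0. \<rho> (x + (- \<delta>) *\<^sub>R w + s *\<^sub>R e_n) < 0"
    using order_tendstoD(1)[OF shift[of \<delta>]] order_tendstoD(2)[OF shift[of "- \<delta>"]] \<delta> by auto
  moreover have "\<forall>\<^sub>F s::real in at_right 0. s < e / 2" "\<forall>\<^sub>F s::real in at_right 0. 0 < s"
    using e by (auto simp: eventually_at_right_less eventually_at_right_field intro!: exI[of _ "e/2"])
  ultimately have "\<forall>\<^sub>F s in at_right 0. 0 < \<rho> (x + \<delta> *\<^sub>R w + s *\<^sub>R e_n) \<and>
      \<rho> (x + (- \<delta>) *\<^sub>R w + s *\<^sub>R e_n) < 0 \<and> s < e / 2 \<and> 0 < s"
    by eventually_elim auto
  then obtain s where s: "0 < \<rho> (x + \<delta> *\<^sub>R w + s *\<^sub>R e_n)"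
      "\<rho> (x + (- \<delta>) *\<^sub>R w + s *\<^sub>R e_n) < 0" "s < e / 2" "0 < s"
    using eventually_happens[of _ "at_right (0::real)"] by (auto simp: trivial_limit_at_right_real)
  have "continuous_on {-\<delta>..\<delta>} (\<lambda>t. \<rho> (x + t *\<^sub>R w + s *\<^sub>R e_n))"
    using s inV by (intro continuous_on_compose2[OF \<rho>(1)] continuous_intros) auto
  then obtain t where t: "-\<delta> \<le> t" "t \<le> \<delta>" "\<rho> (x + t *\<^sub>R w + s *\<^sub>R e_n) = 0"
    using IVT'[of "\<lambda>t. \<rho> (x + t *\<^sub>R w + s *\<^sub>R e_n)" "-\<delta>" 0 \<delta>] s \<delta> by auto
  show thesis
  proof
    show "x + t *\<^sub>R w + s *\<^sub>R e_n \<in> V"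
      using s t by (intro inV) auto
    show "\<rho> (x + t *\<^sub>R w + s *\<^sub>R e_n) = 0" by fact
    show "0 < (x + t *\<^sub>R w + s *\<^sub>R e_n) \<bullet> e_n"
      using s x w by (simp add: inner_add_left wall_def)
  qed
qed

text \<open>In a chart, the frontier of \<open>A\<close> is the zero set of a defining function that is transversal to
  the wall at the corner, so every neighbourhood of the corner contains a zero off the wall.\<close>

lemma corner_in_closure_tomography_set:
  fixes \<A> :: "('p, 'e::euclidean_space) rchart set"
  assumes man: "\<forall>d\<in>\<A>. is_rchart X d"
    and C1: "has_C1_frontier X \<A> A" and orth: "frontier_orthogonal X \<A> A"
    and p: "p \<in> X frontier_of A" "p \<in> bdry \<A>"
  shows "p \<in> X closure_of tomography_set X \<A> A"
proof -
  obtain c \<rho> where c: "c \<in> \<A>" "p \<in> cdom c" and \<rho>: "C1_defining X A c \<rho>"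
    using C1 p by (auto simp: has_C1_frontier_def)
  have rc: "is_rchart X c" using man c by blast
  obtain V where V: "open V" "cmap c ` cdom c \<subseteq> V" "Ck_on 1 V \<rho>"
    using \<rho> by (auto simp: C1_defining_def)
  have xV: "cmap c p \<in> V" using V c by blast
  have diff: "\<rho> differentiable_on V" using V(3) by simp
  then obtain D where D: "(\<rho> has_derivative D) (at (cmap c p))"
    using V(1) xV by (metis at_within_open differentiable_def differentiable_on_def)
  obtain w where w: "w \<in> wall" "0 < D w"
    using orthogonal_imp_transversal[OF rc c p \<rho> orth D] .
  have x: "cmap c p \<bullet> e_n = 0"
    using bdry_on_wall[OF man c p(2)] .
  have \<rho>0: "\<rho> (cmap c p) = 0"
    using \<rho> p c by (auto simp: C1_defining_def)
  have "\<exists>q\<in>tomography_set X \<A> A. q \<in> N" if N: "p \<in> N" "openin X N" for N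
  proof -
    obtain W where W: "open W" "cmap c ` (cdom c \<inter> N) = half_space \<inter> W"
      using rchart_open_image[OF rc N(2)] by (auto simp: openin_open)
    have "cmap c p \<in> V \<inter> W" using xV W c N by auto
    moreover have "open (V \<inter> W)" using V W by blast
    moreover have "continuous_on (V \<inter> W) \<rho>"
      using differentiable_imp_continuous_on[OF diff] continuous_on_subset by blast
    ultimately obtain y where y: "y \<in> V \<inter> W" "\<rho> y = 0" "0 < y \<bullet> e_n"
      using zeros_off_wall[OF _ _ _ \<rho>0 D w x] by blast
    then have "y \<in> cmap c ` (cdom c \<inter> N)"
      using W by (auto simp: half_space_def)
    then obtain q where q: "q \<in> cdom c" "q \<in> N" "y = cmap c q" by blast
    have "q \<in> X frontier_of A"
      using \<rho> q y by (auto simp: C1_defining_def)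
    moreover have "q \<notin> bdry \<A>"
      using bdry_on_wall[OF man c(1) q(1)] y q by auto
    ultimately show ?thesis
      using q by (auto simp: tomography_set_def)
  qed
  moreover have "p \<in> topspace X"
    using p(1) by (simp add: frontier_of_def in_closure_of)
  ultimately show ?thesis
    by (auto simp: in_closure_of)
qed

section \<open>Points and sheets of the reflected manifold\<close>

lemma mem_sheet:
  "q \<in> sheet X \<A> A i \<longleftrightarrow> reflected_proj q \<in> A \<and> q = glue_class X \<A> A (i, reflected_proj q)"
proof
  assume "reflected_proj q \<in> A \<and> q = glue_class X \<A> A (i, reflected_proj q)"
  then show "q \<in> sheet X \<A> A i"
    unfolding sheet_def lift_set_def by blast
qed (auto simp: sheet_def lift_set_def reflected_proj_glue_class)

lemma mem_lift_set:
  "q \<in> lift_set X \<A> A i U \<longleftrightarrow> q \<in> sheet X \<A> A i \<and> reflected_proj q \<in> U"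
proof
  assume "q \<in> sheet X \<A> A i \<and> reflected_proj q \<in> U"
  then show "q \<in> lift_set X \<A> A i U"
    unfolding mem_sheet lift_set_def by blast
qed (auto simp: sheet_def lift_set_def reflected_proj_glue_class)

lemma glued_iff:
  assumes "q \<in> sheet X \<A> A i" "i \<noteq> j"
  shows "q \<in> sheet X \<A> A j \<longleftrightarrow> reflected_proj q \<in> reflecting_closed X \<A> A"
proof -
  obtain p where q: "p \<in> A" "q = glue_class X \<A> A (i, p)" "reflected_proj q = p"
    using assms(1) by (auto simp: mem_sheet)
  have "glue_class X \<A> A (i, p) = glue_class X \<A> A (j, p) \<longleftrightarrow> p \<in> reflecting_closed X \<A> A"
    using q(1) assms(2) by (auto simp: glue_class_def glue_rel_def set_eq_iff)
  then show ?thesis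
    using q by (auto simp: mem_sheet)
qed

lemma reflecting_closed_bdry: "reflecting_closed X \<A> A \<subseteq> bdry \<A>"
  by (auto simp: reflecting_closed_def)

lemma carrier_sheets: "reflected_carrier X \<A> A = (\<Union>i. sheet X \<A> A i)"
  by (auto simp: reflected_carrier_def quotient_def sheet_def lift_set_def glue_class_def)

lemma reflected_proj_mem:
  assumes "q \<in> reflected_carrier X \<A> A" "z \<in> q"
  shows "snd z = reflected_proj q" "reflected_proj q \<in> A"
proof -
  obtain i where i: "reflected_proj q \<in> A" "q = glue_class X \<A> A (i, reflected_proj q)"
    using assms(1) by (auto simp: carrier_sheets mem_sheet)
  then show "reflected_proj q \<in> A" by simp
  have "z \<in> glue_class X \<A> A (i, reflected_proj q)"
    using i assms(2) by blast
  then show "snd z = reflected_proj q"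
    by (auto simp: glue_class_def glue_rel_def)
qed

lemma openin_reflected_space:
  "openin (reflected_space X \<A> A) W \<longleftrightarrow> W \<subseteq> reflected_carrier X \<A> A \<and>
     openin (sum_topology (\<lambda>_::bool. subtopology X A) UNIV) (\<Union>W)"
  unfolding reflected_space_def by (simp add: topology_inverse'[OF istopology_reflected_space])

text \<open>The preimage of \<open>U\<close> consists of the classes whose union is the disjoint union of two copies
  of \<open>U\<close>.\<close>

lemma continuous_map_reflected_proj:
  assumes "A \<subseteq> topspace X"
  shows "continuous_map (reflected_space X \<A> A) (subtopology X A) reflected_proj"
proof -
  have sub: "topspace (reflected_space X \<A> A) \<subseteq> reflected_carrier X \<A> A"
    using openin_reflected_space openin_topspace by blast
  have op: "openin (reflected_space X \<A> A) {q \<in> reflected_carrier X \<A> A. reflected_proj q \<in> U}"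
    if "openin (subtopology X A) U" for U
  proof -
    have UA: "U \<subseteq> A"
      using that by (auto simp: openin_subtopology)
    have "\<Union>{q \<in> reflected_carrier X \<A> A. reflected_proj q \<in> U} = UNIV \<times> U"
    proof (intro set_eqI iffI)
      fix z assume "z \<in> \<Union>{q \<in> reflected_carrier X \<A> A. reflected_proj q \<in> U}"
      then obtain q where "q \<in> reflected_carrier X \<A> A" "reflected_proj q \<in> U" "z \<in> q" by blast
      then have "snd z \<in> U"
        using reflected_proj_mem(1)[of q X \<A> A z] by simp
      then show "z \<in> UNIV \<times> U"
        by (simp add: mem_Times_iff)
    next
      fix z :: "bool \<times> 'a" assume "z \<in> UNIV \<times> U"
      then obtain i p where z: "z = (i, p)" "p \<in> U" "p \<in> A" using UA by auto
      have "glue_class X \<A> A z \<in> reflected_carrier X \<A> A" "z \<in> glue_class X \<A> A z"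
        using z by (auto simp: carrier_sheets sheet_def lift_set_def glue_class_def glue_rel_def)
      moreover have "reflected_proj (glue_class X \<A> A z) \<in> U"
        using z by (simp add: reflected_proj_glue_class)
      ultimately show "z \<in> \<Union>{q \<in> reflected_carrier X \<A> A. reflected_proj q \<in> U}" by blast
    qed
    moreover have "openin (sum_topology (\<lambda>_::bool. subtopology X A) UNIV) (UNIV \<times> U)"
      using that openin_subset[OF that] by (auto simp: openin_sum_topology)
    ultimately show ?thesis
      by (simp add: openin_reflected_space)
  qed
  show ?thesis
    unfolding continuous_map
  proof (intro conjI allI impI)
    show "reflected_proj ` topspace (reflected_space X \<A> A) \<subseteq> topspace (subtopology X A)"
      using sub assms by (fastforce simp: carrier_sheets mem_sheet)
  next
    fix U assume "openin (subtopology X A) U"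
    from openin_Int[OF openin_topspace op[OF this]] sub
    show "openin (reflected_space X \<A> A) {q \<in> topspace (reflected_space X \<A> A). reflected_proj q \<in> U}"
      by (auto elim!: back_subst[where P = "openin (reflected_space X \<A> A)"])
  qed
qed

section \<open>Reflected charts\<close>

lemma boundary_normal_chart_wall:
  assumes "boundary_normal_chart X \<A> c" "y \<in> cmap c ` cdom c" "y \<bullet> e_n = 0"
  shows "cmet c y e_n e_n = 1" "\<And>z. z \<in> wall \<Longrightarrow> cmet c y e_n z = 0"
proof -
  obtain W \<epsilon> where W: "openin (top_of_set wall) W"
      "cmap c ` cdom c = {y + s *\<^sub>R e_n | y s. y \<in> W \<and> 0 \<le> s \<and> s < \<epsilon>}"
      "\<And>y. y \<in> W \<Longrightarrow> cmet c y e_n e_n = 1 \<and> (\<forall>z\<in>wall. cmet c y e_n z = 0)"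
    using assms(1) unfolding boundary_normal_chart_def by (elim conjE exE) auto
  obtain x s where x: "y = x + s *\<^sub>R e_n" "x \<in> W"
    using assms(2) W(2) by blast
  moreover have "x \<bullet> e_n = 0"
    using x(2) openin_imp_subset[OF W(1)] by (auto simp: wall_def)
  ultimately have "y = x"
    using assms(3) by (simp add: inner_add_left)
  then show "cmet c y e_n e_n = 1" "\<And>z. z \<in> wall \<Longrightarrow> cmet c y e_n z = 0"
    using W(3) x by auto
qed

lemma boundary_normal_chart_inner:
  assumes bn: "boundary_normal_chart X \<A> c" and rc: "is_rchart X c"
    and y: "y \<in> cmap c ` cdom c" "y \<bullet> e_n = 0"
  shows "cmet c y e_n v = v \<bullet> e_n" "cmet c y v e_n = v \<bullet> e_n"
proof -
  have bil: "bilinear (cmet c y)" and sym: "cmet c y v w = cmet c y w v" for v w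
    using rc y unfolding is_rchart_def by blast+
  have "cmet c y e_n ((v - (v \<bullet> e_n) *\<^sub>R e_n) + (v \<bullet> e_n) *\<^sub>R e_n) = v \<bullet> e_n"
    using boundary_normal_chart_wall[OF bn y]
    by (simp only: bilinear_radd[OF bil] bilinear_rmul[OF bil]) (simp add: wall_def inner_diff_left)
  then show "cmet c y e_n v = v \<bullet> e_n" by simp
  then show "cmet c y v e_n = v \<bullet> e_n" by (simp add: sym)
qed

text \<open>This makes the two formulas for the reflected metric agree on the wall.\<close>

lemma mirror_isometry_on_wall:
  assumes bn: "boundary_normal_chart X \<A> c" and rc: "is_rchart X c"
    and y: "y \<in> cmap c ` cdom c" "y \<bullet> e_n = 0"
  shows "cmet c y (mirror v) (mirror w) = cmet c y v w"
proof -
  have bil: "bilinear (cmet c y)"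
    using rc y unfolding is_rchart_def by blast
  show ?thesis
    unfolding mirror_def bilinear_lsub[OF bil] bilinear_rsub[OF bil] bilinear_lmul[OF bil]
      bilinear_rmul[OF bil] boundary_normal_chart_inner[OF bn rc y]
    by (simp add: inner_diff_left algebra_simps)
qed

lemma mem_reflected_chart:
  assumes "q \<in> sheet X \<A> A i"
  shows "q \<in> cdom (reflected_chart X \<A> A c) \<longleftrightarrow> reflected_proj q \<in> cdom c"
  using assms by (cases i) (auto simp: reflected_chart_def mem_lift_set)

text \<open>A glued point lies on the wall, which the mirror map fixes. Hence on either closed sheet the
  coordinates are given by a single linear map.\<close>

lemma reflected_chart_cmap:
  assumes man: "\<forall>d\<in>\<A>. is_rchart X d" and c: "c \<in> \<A>"
    and q: "q \<in> sheet X \<A> A i" "reflected_proj q \<in> cdom c"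
  shows "cmap (reflected_chart X \<A> A c) q = flip i (cmap c (reflected_proj q))"
proof (cases "q \<in> sheet X \<A> A True")
  case True
  have "flip i (cmap c (reflected_proj q)) = cmap c (reflected_proj q)"
  proof (cases i)
    case False
    then have "reflected_proj q \<in> bdry \<A>"
      using glued_iff[OF q(1), of True] True reflecting_closed_bdry[of X \<A> A] by auto
    then show ?thesis
      using flip_wall bdry_on_wall[OF man c q(2)] by blast
  qed (simp add: flip_def)
  then show ?thesis
    using True by (simp add: reflected_chart_def)
next
  case False
  then have "\<not> i" using q by (cases i) auto
  then show ?thesis
    using False by (simp add: reflected_chart_def flip_def)
qed

lemma reflected_chart_cmet:
  assumes rc: "is_rchart X c" and bn: "boundary_normal_chart X \<A> c" and y: "y \<in> cmap c ` cdom c"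
  shows "cmet (reflected_chart X \<A> A c) (flip i y) (flip i v) (flip i w) = cmet c y v w"
proof -
  have nn: "0 \<le> y \<bullet> e_n"
    using y rchart_half_space[OF rc] by auto
  consider "i" | "\<not> i" "y \<bullet> e_n = 0" | "\<not> i" "0 < y \<bullet> e_n"
    using nn by (metis less_eq_real_def)
  then show ?thesis
  proof cases
    case 2
    then show ?thesis
      using mirror_isometry_on_wall[OF bn rc y] mirror_wall[of y]
      by (simp add: reflected_chart_def flip_def half_space_def)
  qed (use nn in \<open>simp_all add: reflected_chart_def flip_def half_space_def\<close>)
qed

lemma reflected_chart_atlas:
  "boundary_normal_chart X \<A> c \<Longrightarrow> c \<in> \<A>"
  by (simp add: boundary_normal_chart_def)

lemma not_sheet_chart_at_bdry:
  assumes "d \<in> reflected_charts X \<A> A" "q \<in> cdom d" "reflected_proj q \<in> bdry \<A>"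
  obtains c where "boundary_normal_chart X \<A> c" "d = reflected_chart X \<A> A c"
  using assms by (auto simp: reflected_charts_def sheet_chart_def mem_lift_set mem_sheet)

text \<open>On one sheet, every chart of the reflected manifold is a chart of the original manifold
  followed by the identity or the mirror map, and the metric is the transported one.\<close>

lemma reflected_charts_on_sheet:
  fixes \<A> :: "('p, 'e::euclidean_space) rchart set"
  assumes man: "\<forall>d\<in>\<A>. is_rchart X d"
    and d: "d \<in> reflected_charts X \<A> A" and q: "q \<in> cdom d" "q \<in> sheet X \<A> A i"
  obtains c k where "c \<in> \<A>"
    and "\<forall>q\<in>sheet X \<A> A i. q \<in> cdom d \<longleftrightarrow> reflected_proj q \<in> cdom c"
    and "\<forall>q\<in>sheet X \<A> A i. reflected_proj q \<in> cdom c \<longrightarrow>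
           cmap d q = flip k (cmap c (reflected_proj q))"
    and "\<forall>y\<in>cmap c ` cdom c. \<forall>v w. cmet d (flip k y) (flip k v) (flip k w) = cmet c y v w"
proof -
  consider (sheet) j c where "d = sheet_chart X \<A> A j c" "c \<in> \<A>" "cdom c \<inter> A \<inter> bdry \<A> = {}"
    | (glued) c where "d = reflected_chart X \<A> A c" "boundary_normal_chart X \<A> c"
    using d by (auto simp: reflected_charts_def)
  then show thesis
  proof cases
    case sheet
    \<comment> \<open>The point is not glued, so the chart belongs to its sheet.\<close>
    have "reflected_proj q \<in> cdom c" "q \<in> sheet X \<A> A j"
      using q(1) sheet(1) by (auto simp: sheet_chart_def mem_lift_set)
    moreover have "reflected_proj q \<in> A"
      using q(2) by (simp add: mem_sheet)
    ultimately have "i = j"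
      using glued_iff[OF q(2), of j] sheet(3) reflecting_closed_bdry[of X \<A> A] by blast
    then show thesis
      using sheet by (intro that[of c True]) (auto simp: sheet_chart_def mem_lift_set flip_def)
  next
    case glued
    then have c: "c \<in> \<A>" by (simp add: reflected_chart_atlas)
    then have rc: "is_rchart X c" using man by blast
    show thesis
    proof (rule that[OF c])
      show "\<forall>q\<in>sheet X \<A> A i. q \<in> cdom d \<longleftrightarrow> reflected_proj q \<in> cdom c"
        by (simp add: glued(1) mem_reflected_chart)
      show "\<forall>q\<in>sheet X \<A> A i. reflected_proj q \<in> cdom c \<longrightarrow>
          cmap d q = flip i (cmap c (reflected_proj q))"
        by (simp add: glued(1) reflected_chart_cmap[OF man c])
      show "\<forall>y\<in>cmap c ` cdom c. \<forall>v w. cmet d (flip i y) (flip i v) (flip i w) = cmet c y v w"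
        unfolding glued(1) by (intro ballI allI reflected_chart_cmet[OF rc glued(2)])
    qed
  qed
qed

section \<open>Boundary points of the reflected manifold\<close>

text \<open>Over an interior point of \<open>A\<close> the reflected manifold has no boundary: either the point is
  interior in the original manifold, or the two copies of a half-ball close up to a full
  neighbourhood.\<close>

lemma reflected_bdry_in_frontier:
  assumes man: "\<forall>d\<in>\<A>. is_rchart X d" and cl: "closedin X A" and q: "q \<in> bdry (reflected_charts X \<A> A)"
  shows "reflected_proj q \<in> X frontier_of A"
proof (rule ccontr)
  assume nf: "\<not> ?thesis"
  obtain d where d: "d \<in> reflected_charts X \<A> A" "q \<in> cdom d" "cmap d q \<notin> interior (cmap d ` cdom d)"
    using q by (auto simp: bdry_def)
  let ?p = "reflected_proj q"
  let ?I = "X interior_of A"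
  have IA: "?I \<subseteq> A" by (rule interior_of_subset)
  have in_I: "?p \<in> ?I" if "?p \<in> A"
    using nf that cl by (simp add: frontier_of_def closure_of_closedin)
  consider (sheet) j c where "d = sheet_chart X \<A> A j c" "c \<in> \<A>" "cdom c \<inter> A \<inter> bdry \<A> = {}"
    | (glued) c where "d = reflected_chart X \<A> A c" "boundary_normal_chart X \<A> c"
    using d by (auto simp: reflected_charts_def)
  then show False
  proof cases
    case sheet
    have rc: "is_rchart X c" using man sheet by blast
    have p: "?p \<in> cdom c" "?p \<in> A"
      using d(2) sheet(1) by (auto simp: sheet_chart_def mem_lift_set mem_sheet)
    have img: "cmap c ` (cdom c \<inter> ?I) \<subseteq> cmap d ` cdom d"
    proof
      fix y assume "y \<in> cmap c ` (cdom c \<inter> ?I)"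
      then obtain r where r: "r \<in> cdom c" "r \<in> A" "y = cmap c r" using IA by blast
      then show "y \<in> cmap d ` cdom d"
        by (auto simp: sheet(1) sheet_chart_def lift_set_def image_iff reflected_proj_glue_class)
    qed
    obtain W where W: "open W" "cmap c ` (cdom c \<inter> ?I) = half_space \<inter> W"
      using rchart_open_image[OF rc openin_interior_of] by (auto simp: openin_open)
    have half: "cmap c ` cdom c \<subseteq> half_space"
      using rchart_half_space[OF rc] by (auto simp: half_space_def)
    have "cmap c ?p \<in> interior (cmap c ` cdom c)"
      using bdry_in_chart[OF man sheet(2) p(1)] p sheet(3) by blast
    moreover have "cmap c ?p \<in> W"
      using W p in_I by blast
    moreover have "interior (cmap c ` cdom c) \<inter> W \<subseteq> cmap d ` cdom d"
    proof
      fix y assume "y \<in> interior (cmap c ` cdom c) \<inter> W"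
      then have "y \<in> half_space \<inter> W"
        using half interior_subset[of "cmap c ` cdom c"] by auto
      then show "y \<in> cmap d ` cdom d"
        using img unfolding W(2) by (rule subsetD[rotated])
    qed
    ultimately have "cmap c ?p \<in> interior (cmap d ` cdom d)"
      using W(1) by (intro interiorI[of "interior (cmap c ` cdom c) \<inter> W"]) auto
    moreover have "cmap d q = cmap c ?p"
      by (simp add: sheet(1) sheet_chart_def)
    ultimately show False using d by simp
  next
    case glued
    have c: "c \<in> \<A>" using glued by (simp add: reflected_chart_atlas)
    have rc: "is_rchart X c" using man c by blast
    obtain i where i: "q \<in> sheet X \<A> A i"
      using d(2) by (auto simp: glued(1) reflected_chart_def mem_lift_set)
    have p: "?p \<in> cdom c" "?p \<in> A"
      using d(2) i by (auto simp: glued(1) mem_reflected_chart[OF i] mem_sheet)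
    let ?S = "cmap c ` (cdom c \<inter> ?I)"
    have flips: "flip j y \<in> cmap d ` cdom d" if y: "y \<in> ?S" for j y
    proof -
      obtain r where r: "r \<in> cdom c" "r \<in> A" "y = cmap c r" using y IA by blast
      let ?q = "glue_class X \<A> A (j, r)"
      have j: "?q \<in> sheet X \<A> A j" "reflected_proj ?q = r"
        using r by (simp_all add: mem_sheet reflected_proj_glue_class)
      then have "?q \<in> cdom d" "cmap d ?q = flip j y"
        using r mem_reflected_chart[OF j(1), of c] reflected_chart_cmap[OF man c j(1)]
        by (simp_all add: glued(1))
      then show ?thesis by (metis imageI)
    qed
    have "?S \<union> mirror ` ?S \<subseteq> cmap d ` cdom d"
      using flips[where j = True] flips[where j = False] by (auto simp: flip_def)
    moreover have "open (?S \<union> mirror ` ?S)"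
      by (rule open_double[OF rchart_open_image[OF rc openin_interior_of]])
    moreover have "cmap d q \<in> ?S \<union> mirror ` ?S"
      using reflected_chart_cmap[OF man c i p(1)] p in_I by (cases i) (auto simp: glued(1) flip_def)
    ultimately show False
      using d(3) by (meson interiorI)
  qed
qed

section \<open>Projecting geodesics\<close>

text \<open>A linear isometry transports the metric components and, by the chain rule, their derivatives.
  Testing the given equation with \<open>f z\<close> yields the wanted equation tested with
  \<open>z\<close>.\<close>

lemma geodesic_equation_linear_involution:
  assumes lin: "linear f" and inv: "\<And>x. f (f x) = x"
    and iso: "\<And>y v w. y \<in> S \<Longrightarrow> G' (f y) (f v) (f w) = G y v w"
    and x: "x \<in> S" and geo: "geodesic_equation G' (f ` S) (f x) (f v) (f a)"
  shows "geodesic_equation G S x v a"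
  unfolding geodesic_equation_def
proof (intro allI impI)
  fix z D1 D2
  assume D: "((\<lambda>y. G y v z) has_derivative D1) (at x within S)"
    "((\<lambda>y. G y v v) has_derivative D2) (at x within S)"
  have transport: "((\<lambda>y. G' y (f v) (f w)) has_derivative D \<circ> f) (at (f x) within f ` S)"
    if "((\<lambda>y. G y v w) has_derivative D) (at x within S)" for D w
  proof -
    have "(f has_derivative f) (at (f x) within f ` S)"
      by (rule linear_imp_has_derivative[OF lin])
    moreover have "f ` f ` S = S"
      by (simp add: image_image inv)
    ultimately have "((\<lambda>y. G y v w) \<circ> f has_derivative D \<circ> f) (at (f x) within f ` S)"
      using that by (intro diff_chain_within) (simp_all add: inv)
    then show ?thesis
      by (rule has_derivative_transform[rotated 2]) (use x iso inv in auto)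
  qed
  have "G' (f x) (f a) (f z) + (D1 \<circ> f) (f v) - (D2 \<circ> f) (f z) / 2 = 0"
    using geo transport[OF D(1)] transport[OF D(2)] unfolding geodesic_equation_def by blast
  then show "G x a z + D1 v - D2 z / 2 = 0"
    by (simp add: iso[OF x] inv)
qed

lemma eventually_in_open:
  assumes "continuous_map (top_of_set S) X \<gamma>" "openin X U" "t \<in> S" "\<gamma> t \<in> U"
  shows "\<forall>\<^sub>F s in at t within S. \<gamma> s \<in> U"
proof -
  have "openin (top_of_set S) {s \<in> S. \<gamma> s \<in> U}"
    using openin_continuous_map_preimage[OF assms(1,2)] by simp
  then obtain W where W: "open W" "{s \<in> S. \<gamma> s \<in> U} = S \<inter> W"
    by (auto simp: openin_open)
  then show ?thesis
    using assms(3,4) by (auto simp: eventually_at_topological intro!: exI[of _ W])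
qed

lemma has_vector_derivative_linear_transform:
  fixes f :: "'e::euclidean_space \<Rightarrow> 'e"
  assumes f: "linear f" and der: "(\<phi> has_vector_derivative u) (at t within S)"
    and ev: "\<forall>\<^sub>F s in at t within S. \<psi> s = f (\<phi> s)" and at: "\<psi> t = f (\<phi> t)"
  shows "(\<psi> has_vector_derivative f u) (at t within S)"
proof -
  have "((\<lambda>s. f (\<phi> s)) has_vector_derivative f u) (at t within S)"
    by (rule bounded_linear.has_vector_derivative[OF _ der]) (simp add: f linear_conv_bounded_linear[symmetric])
  moreover have "\<forall>\<^sub>F s in nhds t. s \<in> S \<longrightarrow> \<psi> s = f (\<phi> s)"
    using ev at unfolding eventually_at_filter by (auto elim!: eventually_mono)
  ultimately show ?thesis
    using has_vector_derivative_cong_ev[of S \<psi> "\<lambda>s. f (\<phi> s)" t] at by simp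
qed

text \<open>The coordinate expression of the projection is defined by the chart only as long as the curve stays
  in the chart domain; continuity guarantees this near each time, which suffices for the
  derivatives.\<close>

lemma geodesic_in_project:
  fixes \<A> :: "('p, 'e::euclidean_space) rchart set"
  assumes man: "\<forall>d\<in>\<A>. is_rchart X d"
    and geo: "geodesic_in (reflected_charts X \<A> A) (sheet X \<A> A i) a b \<gamma>"
    and cont: "continuous_map (top_of_set {a..b}) X (reflected_proj \<circ> \<gamma>)"
  shows "geodesic_in \<A> A a b (reflected_proj \<circ> \<gamma>)"
proof -
  have sh: "\<gamma> s \<in> sheet X \<A> A i" if "s \<in> {a..b}" for s
    using geo that by (auto simp: geodesic_in_def)
  have charts: "\<exists>c\<in>\<A>. (reflected_proj \<circ> \<gamma>) t \<in> cdom c \<and>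
        (\<exists>x' x''. \<forall>s\<in>{a..b}. (reflected_proj \<circ> \<gamma>) s \<in> cdom c \<longrightarrow>
           ((cmap c \<circ> (reflected_proj \<circ> \<gamma>)) has_vector_derivative x' s) (at s within {a..b}) \<and>
           (x' has_vector_derivative x'' s) (at s within {a..b}) \<and>
           cmet c (cmap c ((reflected_proj \<circ> \<gamma>) s)) (x' s) (x' s) = 1 \<and>
           geodesic_equation (cmet c) (cmap c ` (cdom c \<inter> A))
             (cmap c ((reflected_proj \<circ> \<gamma>) s)) (x' s) (x'' s))" if t: "t \<in> {a..b}" for t
  proof -
    obtain d x' x'' where d: "d \<in> reflected_charts X \<A> A" "\<gamma> t \<in> cdom d"
      and x_all: "\<forall>s\<in>{a..b}. \<gamma> s \<in> cdom d \<longrightarrow>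
           ((cmap d \<circ> \<gamma>) has_vector_derivative x' s) (at s within {a..b}) \<and>
           (x' has_vector_derivative x'' s) (at s within {a..b}) \<and>
           cmet d (cmap d (\<gamma> s)) (x' s) (x' s) = 1 \<and>
           geodesic_equation (cmet d) (cmap d ` (cdom d \<inter> sheet X \<A> A i)) (cmap d (\<gamma> s)) (x' s) (x'' s)"
      using conjunct2[OF geo[unfolded geodesic_in_def], THEN bspec, OF t]
      by (elim bexE conjE exE) (rule that)
    note x = x_all[rule_format]
    obtain c k where c: "c \<in> \<A>"
      and dom_all: "\<forall>q\<in>sheet X \<A> A i. q \<in> cdom d \<longleftrightarrow> reflected_proj q \<in> cdom c"
      and map_all: "\<forall>q\<in>sheet X \<A> A i. reflected_proj q \<in> cdom c \<longrightarrow>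
           cmap d q = flip k (cmap c (reflected_proj q))"
      and met_all: "\<forall>y\<in>cmap c ` cdom c. \<forall>v w.
           cmet d (flip k y) (flip k v) (flip k w) = cmet c y v w"
      by (rule reflected_charts_on_sheet[OF man d sh[OF t]])
    note dom = bspec[OF dom_all] and map = map_all[rule_format] and met = met_all[rule_format]
    have oc: "openin X (cdom c)" using man c by (auto simp: is_rchart_def)
    have img: "cmap d ` (cdom d \<inter> sheet X \<A> A i) = flip k ` cmap c ` (cdom c \<inter> A)"
    proof (intro set_eqI iffI)
      fix y assume "y \<in> cmap d ` (cdom d \<inter> sheet X \<A> A i)"
      then obtain q where "q \<in> cdom d" "q \<in> sheet X \<A> A i" "y = cmap d q" by blast
      then show "y \<in> flip k ` cmap c ` (cdom c \<inter> A)"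
        using dom map by (auto simp: mem_sheet)
    next
      fix y assume "y \<in> flip k ` cmap c ` (cdom c \<inter> A)"
      then obtain r where r: "r \<in> cdom c" "r \<in> A" "y = flip k (cmap c r)" by blast
      let ?q = "glue_class X \<A> A (i, r)"
      have "?q \<in> sheet X \<A> A i" "reflected_proj ?q = r"
        using r by (simp_all add: mem_sheet reflected_proj_glue_class)
      then have "?q \<in> cdom d \<inter> sheet X \<A> A i" "y = cmap d ?q"
        using dom map r by auto
      then show "y \<in> cmap d ` (cdom d \<inter> sheet X \<A> A i)" by blast
    qed
    have step: "((cmap c \<circ> (reflected_proj \<circ> \<gamma>)) has_vector_derivative flip k (x' s)) (at s within {a..b}) \<and>
           ((\<lambda>s. flip k (x' s)) has_vector_derivative flip k (x'' s)) (at s within {a..b}) \<and>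
           cmet c (cmap c ((reflected_proj \<circ> \<gamma>) s)) (flip k (x' s)) (flip k (x' s)) = 1 \<and>
           geodesic_equation (cmet c) (cmap c ` (cdom c \<inter> A))
             (cmap c ((reflected_proj \<circ> \<gamma>) s)) (flip k (x' s)) (flip k (x'' s))"
      if s: "s \<in> {a..b}" "(reflected_proj \<circ> \<gamma>) s \<in> cdom c" for s
    proof -
      have sd: "\<gamma> s \<in> cdom d" using dom[OF sh[OF s(1)]] s by simp
      have eq: "cmap c (reflected_proj (\<gamma> r)) = flip k (cmap d (\<gamma> r))"
        if "r \<in> {a..b}" "reflected_proj (\<gamma> r) \<in> cdom c" for r
        using map[OF sh[OF that(1)] that(2)] by simp
      have "\<forall>\<^sub>F r in at s within {a..b}. r \<in> {a..b} \<and> (reflected_proj \<circ> \<gamma>) r \<in> cdom c"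
        using eventually_in_open[OF cont oc s] by (auto simp: eventually_at_filter elim: eventually_mono)
      then have "\<forall>\<^sub>F r in at s within {a..b}.
          (cmap c \<circ> (reflected_proj \<circ> \<gamma>)) r = flip k ((cmap d \<circ> \<gamma>) r)"
        by eventually_elim (use eq in auto)
      moreover have der: "((cmap d \<circ> \<gamma>) has_vector_derivative x' s) (at s within {a..b})"
        "(x' has_vector_derivative x'' s) (at s within {a..b})"
        using x[OF s(1) sd] by blast+
      ultimately have 1:
        "((cmap c \<circ> (reflected_proj \<circ> \<gamma>)) has_vector_derivative flip k (x' s)) (at s within {a..b})"
        by (intro has_vector_derivative_linear_transform[OF linear_flip der(1)]) (use eq s in auto)
      have 2: "((\<lambda>s. flip k (x' s)) has_vector_derivative flip k (x'' s)) (at s within {a..b})"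
        by (rule has_vector_derivative_linear_transform[OF linear_flip der(2)]) simp_all
      let ?y = "cmap c (reflected_proj (\<gamma> s))"
      have y: "?y \<in> cmap c ` cdom c" "cmap d (\<gamma> s) = flip k ?y"
        using s map[OF sh[OF s(1)]] by auto
      have 3: "cmet c ?y (flip k (x' s)) (flip k (x' s)) = 1"
        using x[OF s(1) sd] met[OF y(1), of "flip k (x' s)" "flip k (x' s)"] by (simp add: y(2))
      have 4: "geodesic_equation (cmet c) (cmap c ` (cdom c \<inter> A)) ?y (flip k (x' s)) (flip k (x'' s))"
      proof (rule geodesic_equation_linear_involution[where f = "flip k" and G' = "cmet d"])
        show "?y \<in> cmap c ` (cdom c \<inter> A)"
          using s sh[OF s(1)] by (auto simp: mem_sheet)
        show "geodesic_equation (cmet d) (flip k ` cmap c ` (cdom c \<inter> A)) (flip k ?y)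
            (flip k (flip k (x' s))) (flip k (flip k (x'' s)))"
          using x[OF s(1) sd] by (simp add: img y(2))
      qed (use met in \<open>auto simp: linear_flip\<close>)
      show ?thesis using 1 2 3 4 by simp
    qed
    have tc: "(reflected_proj \<circ> \<gamma>) t \<in> cdom c"
      using dom[OF sh[OF t]] d by simp
    show ?thesis
      by (rule bexI[OF _ c], rule conjI[OF tc], intro exI[of _ "\<lambda>s. flip k (x' s)"]
          exI[of _ "\<lambda>s. flip k (x'' s)"] ballI impI, rule step)
  qed
  have sub: "(reflected_proj \<circ> \<gamma>) ` {a..b} \<subseteq> A"
    using sh by (auto simp: mem_sheet)
  show ?thesis
    unfolding geodesic_in_def by (rule conjI[OF sub], rule ballI, rule charts)
qed

text \<open>Write \<open>u\<close> for the velocity of the \<open>C\<^sup>1\<close> curve in the reflected chart. If the curve changes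
  sheets, one of the one-sided velocities of the projection is \<open>u\<close> and the other one its mirror image.
  If it stays on one sheet, it touches the wall from one side, hence is tangent to it, and then \<open>u\<close>
  is its own mirror image.\<close>

lemma crossing_reflects:
  fixes \<A> :: "('p, 'e::euclidean_space) rchart set"
  assumes man: "\<forall>d\<in>\<A>. is_rchart X d"
    and cont: "continuous_map (top_of_set {0..L}) X (reflected_proj \<circ> \<gamma>)"
    and C1: "C1_curve (reflected_charts X \<A> A) L \<gamma>"
    and t: "0 \<le> a" "a < t" "t < b" "b \<le> L"
    and left: "\<And>s. s \<in> {a..t} \<Longrightarrow> \<gamma> s \<in> sheet X \<A> A i"
    and right: "\<And>s. s \<in> {t..b} \<Longrightarrow> \<gamma> s \<in> sheet X \<A> A j"
    and glued: "reflected_proj (\<gamma> t) \<in> reflecting_closed X \<A> A"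
  shows "\<exists>c\<in>\<A>. (reflected_proj \<circ> \<gamma>) t \<in> cdom c \<and> reflects_in c wall (reflected_proj \<circ> \<gamma>) t"
proof -
  have tL: "t \<in> {0..L}" using t by auto
  have bd: "reflected_proj (\<gamma> t) \<in> bdry \<A>"
    by (rule subsetD[OF reflecting_closed_bdry glued])
  obtain d u where d: "d \<in> reflected_charts X \<A> A" "\<gamma> t \<in> cdom d"
      and u: "((cmap d \<circ> \<gamma>) has_vector_derivative u) (at t within {0..L})"
    using C1 tL unfolding C1_curve_def by blast
  obtain c where bn: "boundary_normal_chart X \<A> c" and dc: "d = reflected_chart X \<A> A c"
    using not_sheet_chart_at_bdry[OF d bd] .
  have c: "c \<in> \<A>" using bn by (rule reflected_chart_atlas)
  have rc: "is_rchart X c" using man c by blast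
  then have oc: "openin X (cdom c)" by (simp add: is_rchart_def)
  have pc: "reflected_proj (\<gamma> t) \<in> cdom c"
    using d(2) mem_reflected_chart[OF left[of t]] t by (simp add: dc)
  let ?\<sigma> = "cmap c \<circ> (reflected_proj \<circ> \<gamma>)"
  have wall: "?\<sigma> t \<bullet> e_n = 0"
    using bdry_on_wall[OF man c pc bd] by simp
  have at: "at t within {0..L} = at t"
    using t by (intro at_within_interior) auto
  have u': "((cmap d \<circ> \<gamma>) has_vector_derivative u) (at t)"
    using u by (simp add: at)
  have near: "\<forall>\<^sub>F s in at t. reflected_proj (\<gamma> s) \<in> cdom c"
    using eventually_in_open[OF cont oc tL] pc by (simp add: at)
  have coord: "?\<sigma> s = flip k ((cmap d \<circ> \<gamma>) s)"
    if "\<gamma> s \<in> sheet X \<A> A k" "reflected_proj (\<gamma> s) \<in> cdom c" for s k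
    using reflected_chart_cmap[OF man c that] by (simp add: dc)
  have evl: "\<forall>\<^sub>F s in at_left t. ?\<sigma> s = flip i ((cmap d \<circ> \<gamma>) s)"
  proof -
    have "\<forall>\<^sub>F s in at_left t. s \<in> {a<..<t}"
      using t by (intro eventually_at_left_real)
    moreover have "\<forall>\<^sub>F s in at_left t. reflected_proj (\<gamma> s) \<in> cdom c"
      using near by (simp add: eventually_at_split)
    ultimately show ?thesis
      by eventually_elim (use coord left in auto)
  qed
  have evr: "\<forall>\<^sub>F s in at_right t. ?\<sigma> s = flip j ((cmap d \<circ> \<gamma>) s)"
  proof -
    have "\<forall>\<^sub>F s in at_right t. s \<in> {t<..<b}"
      using t by (intro eventually_at_right_real)
    moreover have "\<forall>\<^sub>F s in at_right t. reflected_proj (\<gamma> s) \<in> cdom c"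
      using near by (simp add: eventually_at_split)
    ultimately show ?thesis
      by eventually_elim (use coord right in auto)
  qed
  have "((cmap d \<circ> \<gamma>) has_vector_derivative u) (at_left t)"
    using u' by (rule has_vector_derivative_at_within)
  then have l: "(?\<sigma> has_vector_derivative flip i u) (at_left t)"
    by (rule has_vector_derivative_linear_transform[OF linear_flip _ evl])
       (use left t coord pc in auto)
  have "((cmap d \<circ> \<gamma>) has_vector_derivative u) (at_right t)"
    using u' by (rule has_vector_derivative_at_within)
  then have r: "(?\<sigma> has_vector_derivative flip j u) (at_right t)"
    by (rule has_vector_derivative_linear_transform[OF linear_flip _ evr])
       (use right t coord pc in auto)
  have "flip j u = mirror (flip i u)"
  proof (cases "i = j")
    case True
    \<comment> \<open>The height over the wall is differentiable at \<open>t\<close> and has a local minimum there.\<close>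
    have ev: "\<forall>\<^sub>F s in at t. ?\<sigma> s = flip i ((cmap d \<circ> \<gamma>) s)"
      using evl evr True by (simp add: eventually_at_split)
    have "(?\<sigma> has_vector_derivative flip i u) (at t)"
      by (rule has_vector_derivative_linear_transform[OF linear_flip u' ev])
         (use left t coord pc in auto)
    then have der: "((\<lambda>s. ?\<sigma> s \<bullet> e_n) has_real_derivative flip i u \<bullet> e_n) (at t)"
      unfolding has_real_derivative_iff_has_vector_derivative
      by (rule bounded_linear.has_vector_derivative[OF bounded_linear_inner_left])
    obtain \<delta> where "0 < \<delta>" "\<And>s. \<lbrakk>s \<noteq> t; dist s t < \<delta>\<rbrakk> \<Longrightarrow> reflected_proj (\<gamma> s) \<in> cdom c"
      using near by (auto simp: eventually_at)
    then have "\<forall>s. \<bar>t - s\<bar> < \<delta> \<longrightarrow> ?\<sigma> t \<bullet> e_n \<le> ?\<sigma> s \<bullet> e_n"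
      using rchart_half_space[OF rc] wall pc by (metis abs_minus_commute comp_apply dist_real_def)
    then have "flip i u \<bullet> e_n = 0"
      using DERIV_local_min[OF der \<open>0 < \<delta>\<close>] by blast
    then show ?thesis
      using True by (simp add: mirror_wall)
  qed (rule flip_other)
  moreover have y: "?\<sigma> t \<in> cmap c ` cdom c" using pc by simp
  ultimately have "reflects_in c wall (reflected_proj \<circ> \<gamma>) t"
    unfolding reflects_in_def normal_at_def
    using l r boundary_normal_chart_inner[OF bn rc y wall] boundary_normal_chart_wall[OF bn y wall]
    by (intro exI[of _ "flip i u"] exI[of _ "flip j u"] exI[of _ e_n]) (auto simp: mirror_def)
  then show ?thesis
    using c pc by auto
qed

section \<open>The reduction\<close>

text \<open>The subdivision of the geodesic by its changes of sheet serves as the subdivision of the broken ray by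
  its reflections. A point of the subdivision at which the sheet does not change is a tangential contact
  and counts as a trivial reflection.\<close>

lemma reflected_geodesic_project:
  fixes \<A> :: "('p, 'e::euclidean_space) rchart set"
  assumes man: "\<forall>d\<in>\<A>. is_rchart X d" and cl: "closedin X A"
    and C1: "has_C1_frontier X \<A> A" and orth: "frontier_orthogonal X \<A> A"
    and \<gamma>: "(L, \<gamma>) \<in> reflected_geodesics X \<A> A"
  shows "(L, reflected_proj \<circ> \<gamma>) \<in> broken_rays X \<A> A"
proof -
  let ?\<gamma> = "reflected_proj \<circ> \<gamma>"
  have L: "0 < L" and cont: "continuous_map (top_of_set {0..L}) (reflected_space X \<A> A) \<gamma>"
    and C1c: "C1_curve (reflected_charts X \<A> A) L \<gamma>"
    and ends: "\<gamma> 0 \<in> bdry (reflected_charts X \<A> A)" "\<gamma> L \<in> bdry (reflected_charts X \<A> A)"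
    using \<gamma> by (auto simp: reflected_geodesics_def joining_geodesics_def)
  obtain k P where P: "subdivision L k P"
    and geo: "\<forall>i<k. \<exists>T\<in>range (sheet X \<A> A). geodesic_in (reflected_charts X \<A> A) T (P i) (P (Suc i)) \<gamma>"
    and Z: "\<And>i. i \<in> {0<..<k} \<Longrightarrow> \<gamma> (P i) \<in> sheet X \<A> A True \<inter> sheet X \<A> A False"
    using \<gamma> unfolding reflected_geodesics_def joining_geodesics_def by auto
  have "\<forall>i. \<exists>j. i < k \<longrightarrow>
      geodesic_in (reflected_charts X \<A> A) (sheet X \<A> A j) (P i) (P (Suc i)) \<gamma>"
    using geo by auto
  from choice[OF this] obtain \<tau> where \<tau>: "\<And>i. i < k \<Longrightarrow>
      geodesic_in (reflected_charts X \<A> A) (sheet X \<A> A (\<tau> i)) (P i) (P (Suc i)) \<gamma>"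
    by blast
  have contA: "continuous_map (top_of_set {0..L}) (subtopology X A) ?\<gamma>"
    using continuous_map_compose[OF cont continuous_map_reflected_proj] cl closedin_subset by blast
  then have contX: "continuous_map (top_of_set {0..L}) X ?\<gamma>"
    by (simp add: continuous_map_in_subtopology)
  have P0: "P 0 = 0" "P k = L" and Pstep: "\<And>i. i < k \<Longrightarrow> P i < P (Suc i)"
    using P by (auto simp: subdivision_def)
  have mono: "j \<le> k \<longrightarrow> P i \<le> P j" if "i \<le> j" for i j
    using that
  proof (induction rule: dec_induct)
    case (step n)
    then show ?case using Pstep[of n] by auto
  qed simp
  have range: "0 \<le> P i" "P i \<le> L" if "i \<le> k" for i
    using mono[of 0 i] mono[of i k] that P0 by auto
  have endpoint: "reflected_proj q \<in> X closure_of tomography_set X \<A> A"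
    if "q \<in> bdry (reflected_charts X \<A> A)" for q
  proof -
    have f: "reflected_proj q \<in> X frontier_of A"
      using reflected_bdry_in_frontier[OF man cl that] .
    show ?thesis
    proof (cases "reflected_proj q \<in> bdry \<A>")
      case False
      then show ?thesis
        using f closure_of_subset_Int[of X "tomography_set X \<A> A"]
        by (auto simp: tomography_set_def frontier_of_def in_closure_of)
    qed (rule corner_in_closure_tomography_set[OF man C1 orth f])
  qed
  have pieces: "geodesic_in \<A> A (P i) (P (Suc i)) ?\<gamma>" if "i < k" for i
  proof (rule geodesic_in_project[OF man \<tau>[OF that]])
    have "{P i..P (Suc i)} \<subseteq> {0..L}"
      using range[of i] range[of "Suc i"] that by auto
    then show "continuous_map (top_of_set {P i..P (Suc i)}) X ?\<gamma>"
      by (rule continuous_map_from_subtopology_mono[OF contX])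
  qed
  have breaks: "?\<gamma> (P i) \<in> reflecting_closed X \<A> A \<and>
      (\<exists>c\<in>\<A>. ?\<gamma> (P i) \<in> cdom c \<and> reflects_in c wall ?\<gamma> (P i))" if i: "i \<in> {0<..<k}" for i
  proof -
    obtain m where m: "i = Suc m" using i by (cases i) auto
    have glued: "reflected_proj (\<gamma> (P i)) \<in> reflecting_closed X \<A> A"
      using Z[OF i] glued_iff[of "\<gamma> (P i)" X \<A> A True False] by simp
    have "\<exists>c\<in>\<A>. ?\<gamma> (P i) \<in> cdom c \<and> reflects_in c wall ?\<gamma> (P i)"
    proof (rule crossing_reflects[OF man contX C1c _ _ _ _ _ _ glued])
      show "0 \<le> P m" "P m < P i" "P i < P (Suc i)" "P (Suc i) \<le> L"
        using range[of m] range[of "Suc i"] Pstep[of m] Pstep[of i] i m by auto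
      show "\<gamma> s \<in> sheet X \<A> A (\<tau> m)" if "s \<in> {P m..P i}" for s
        using \<tau>[of m] i m that by (auto simp: geodesic_in_def)
      show "\<gamma> s \<in> sheet X \<A> A (\<tau> i)" if "s \<in> {P i..P (Suc i)}" for s
        using \<tau>[of i] i that by (auto simp: geodesic_in_def)
    qed
    with glued show ?thesis by simp
  qed
  show ?thesis
    unfolding broken_rays_def
    using L contA endpoint[OF ends(1)] endpoint[OF ends(2)] P pieces breaks
    by (auto intro!: exI[of _ k] exI[of _ P])
qed

lemma ray_transform_lift:
  "ray_transform (lift_fun h) (lift_fun f) (L, \<gamma>) = ray_transform h f (L, reflected_proj \<circ> \<gamma>)"
  by (simp add: ray_transform_def lift_fun_def)

lemma lift_fun_eqD:
  assumes "\<forall>q\<in>reflected_carrier X \<A> A. lift_fun f q = lift_fun f' q" "x \<in> A"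
  shows "f x = f' x"
proof -
  have "glue_class X \<A> A (True, x) \<in> reflected_carrier X \<A> A"
    using assms(2) by (auto simp: carrier_sheets mem_sheet reflected_proj_glue_class)
  with assms show ?thesis
    by (force simp: lift_fun_def reflected_proj_glue_class)
qed

theorem theorem16:
  fixes X :: "'p topology"
    and \<A> :: "('p, 'e::euclidean_space) rchart set"
    and A :: "'p set"
    and F H :: "('p \<Rightarrow> real) set"
  assumes "riemannian_manifold X \<A>"
    and "compact_space X"
    and "A = X closure_of (X interior_of A)"
    and "A \<inter> bdry \<A> \<noteq> {}"
    and "has_C1_frontier X \<A> A"
    and "frontier_orthogonal X \<A> A"
  shows "(determines_both (reflected_carrier X \<A> A) (reflected_geodesics X \<A> A)
            (lift_fun ` F) (lift_fun ` H) \<longrightarrow>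
          determines_both A (broken_rays X \<A> A) F H) \<and>
         (\<forall>h\<in>H. determines_for (lift_fun h) (reflected_carrier X \<A> A) (reflected_geodesics X \<A> A)
            (lift_fun ` F) \<longrightarrow>
          determines_for h A (broken_rays X \<A> A) F)"
proof -
  have man: "\<forall>d\<in>\<A>. is_rchart X d"
    using assms(1) unfolding riemannian_manifold_def by (elim conjE)
  have cl: "closedin X A"
    using closedin_closure_of[of X "X interior_of A"] unfolding assms(3)[symmetric] .
  have transfer: "\<forall>\<gamma>\<in>reflected_geodesics X \<A> A.
      ray_transform (lift_fun h) (lift_fun f) \<gamma> = ray_transform (lift_fun h') (lift_fun f') \<gamma>"
    if "\<forall>\<gamma>\<in>broken_rays X \<A> A. ray_transform h f \<gamma> = ray_transform h' f' \<gamma>" for h h' f f'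
  proof
    fix \<gamma> assume "\<gamma> \<in> reflected_geodesics X \<A> A"
    then have "(fst \<gamma>, reflected_proj \<circ> snd \<gamma>) \<in> broken_rays X \<A> A"
      using reflected_geodesic_project[OF man cl assms(5,6), of "fst \<gamma>" "snd \<gamma>"] by simp
    with that show "ray_transform (lift_fun h) (lift_fun f) \<gamma> = ray_transform (lift_fun h') (lift_fun f') \<gamma>"
      using ray_transform_lift[of _ _ "fst \<gamma>" "snd \<gamma>"] by simp
  qed
  show ?thesis
  proof (intro conjI impI ballI)
    assume det: "determines_both (reflected_carrier X \<A> A) (reflected_geodesics X \<A> A)
        (lift_fun ` F) (lift_fun ` H)"
    show "determines_both A (broken_rays X \<A> A) F H"
      unfolding determines_both_def
    proof (intro ballI impI)
      fix f f' h h'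
      assume mem: "f \<in> F" "f' \<in> F" "h \<in> H" "h' \<in> H"
        and "\<forall>\<gamma>\<in>broken_rays X \<A> A. ray_transform h f \<gamma> = ray_transform h' f' \<gamma>"
      then have "(\<forall>q\<in>reflected_carrier X \<A> A. lift_fun h q = lift_fun h' q) \<and>
          (\<forall>q\<in>reflected_carrier X \<A> A. lift_fun f q = lift_fun f' q)"
        using det transfer[of h f h' f'] unfolding determines_both_def by blast
      then show "(\<forall>x\<in>A. h x = h' x) \<and> (\<forall>x\<in>A. f x = f' x)"
        using lift_fun_eqD[of X \<A> A h h'] lift_fun_eqD[of X \<A> A f f'] by blast
    qed
  next
    fix h
    assume det: "determines_for (lift_fun h) (reflected_carrier X \<A> A) (reflected_geodesics X \<A> A)
        (lift_fun ` F)"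
    show "determines_for h A (broken_rays X \<A> A) F"
      unfolding determines_for_def
    proof (intro ballI impI)
      fix f f' x
      assume "f \<in> F" "f' \<in> F" "x \<in> A"
        and "\<forall>\<gamma>\<in>broken_rays X \<A> A. ray_transform h f \<gamma> = ray_transform h f' \<gamma>"
      then show "f x = f' x"
        using det transfer[of h f h f'] lift_fun_eqD[of X \<A> A f f' x]
        unfolding determines_for_def by blast
    qed
  qed
qed

end
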